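(* Let $K\subset\mathbb{R}^n$ be a convex body with the origin in its interior, and for real $p$ let $S_p(K)=nV_p(K,B_2^n)$ denote its $p$-surface area. (i) For every real $p\ge0$, $$\frac{\tilde G_p(K)}{\tilde G_p(B_2^n)}\le\left(\frac{S_p(K)}{S_p(B_2^n)}\right)^{\frac n{n+p}}.$$ (ii) For every real $p<0$ with $p\neq -n$, $$\frac{\tilde G_p(K)}{\tilde G_p(B_2^n)}\ge\left(\frac{S_p(K)}{S_p(B_2^n)}\right)^{\frac n{n+p}}.$$
   Context: Fix an integer $n\ge1$. A convex body in $\mathbb{R}^n$ is a compact convex set with nonempty interior; $\mathcal{K}_0$ is the set of convex bodies containing the origin in their interior. For $K\in\mathcal{K}_0$, $K^\circ=\{y:\langle x,y\rangle\le1\ \forall x\in K\}$ is the polar body, $h_K(u)=\max_{x\in K}\langle x,u\rangle$ ($u\in S^{n-1}$) the support function, $|\cdot|$ is volume, $B_2^n$ is the Euclidean unit ball. $S(K,\cdot)$ is the surface area measure of $K$ on $S^{n-1}$: $S(K,A)$ is the $(n-1)$-dimensional Hausdorff measure of the set of $x\in\partial K$ at which $K$ has an outer unit normal in $A$. For $p\in\mathbb{R}$ and $K,Q\in\mathcal{K}_0$, $$V_p(K,Q)=\frac1n\int_{S^{n-1}}h_Q(u)^p\,h_K(u)^{1-p}\,dS(K,u).$$ The $L_p$ geominimal surface area of $K\in\mathcal{K}_0$ is $$\tilde G_p(K)=\inf_{Q\in\mathcal{K}_0}\Big\{n\,V_p(K,Q)^{\frac n{n+p}}|Q^\circ|^{\frac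 p{n+p}}\Big\}\ (p\ge0),\qquad \tilde G_p(K)=\sup_{Q\in\mathcal{K}_0}\Big\{n\,V_p(K,Q)^{\frac n{n+p}}|Q^\circ|^{\frac p{n+p}}\Big\}\ (-n\ne p<0),$$ the supremum being taken in $(0,+\infty]$. *)

theory Defs
  imports "HOL-Analysis.Analysis"
begin

definition convex_body :: "(real^'n) set \<Rightarrow> bool" where
  "convex_body K \<longleftrightarrow> compact K \<and> convex K \<and> interior K \<noteq> {}"

definition convex_bodies0 :: "(real^'n) set set" where
  "convex_bodies0 = {K. convex_body K \<and> 0 \<in> interior K}"

definition polar_body :: "(real^'n) set \<Rightarrow> (real^'n) set" where
  "polar_body K = {y. \<forall>x\<in>K. x \<bullet> y \<le> 1}"

definition support_function :: "(real^'n) set \<Rightarrow> real^'n \<Rightarrow> real" where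
  "support_function K u = (SUP x\<in>K. x \<bullet> u)"

text \<open>
  Hausdorff measure of natural dimension \<open>d\<close>, with the normalisation that makes it agree with
  Lebesgue measure on \<open>d\<close>-dimensional Euclidean space. The weight of a covering set is the volume
  of the \<open>d\<close>-dimensional ball of the same diameter. For \<open>d = 0\<close> a nonempty set has weight 1 and
  the empty set must have weight 0 (so that the result is counting measure), but \<open>0 ^ 0 = 1\<close>;
  hence the case distinction. Boundedness is required because \<open>diameter\<close> is unspecified on
  unbounded sets.
\<close>

definition hausdorff_weight :: "nat \<Rightarrow> 'a::metric_space set \<Rightarrow> ennreal" where
  "hausdorff_weight d U =
     (if U = {} then 0 else ennreal (unit_ball_vol (real d) * (diameter U / 2) ^ d))"

definition hausdorff_premeasure :: "nat \<Rightarrow> real \<Rightarrow> 'a::metric_space set \<Rightarrow> ennreal" where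
  "hausdorff_premeasure d \<delta> A =
     (INF U\<in>{U :: nat \<Rightarrow> 'a set. A \<subseteq> (\<Union>i. U i) \<and> (\<forall>i. bounded (U i) \<and> diameter (U i) \<le> \<delta>)}.
        \<Sum>i. hausdorff_weight d (U i))"

definition hausdorff_measure :: "nat \<Rightarrow> 'a::metric_space set \<Rightarrow> ennreal" where
  "hausdorff_measure d A = (SUP \<delta>\<in>{0<..}. hausdorff_premeasure d \<delta> A)"

definition outer_unit_normal :: "(real^'n) set \<Rightarrow> real^'n \<Rightarrow> real^'n \<Rightarrow> bool" where
  "outer_unit_normal K x u \<longleftrightarrow> norm u = 1 \<and> (\<forall>y\<in>K. (y - x) \<bullet> u \<le> 0)"

text \<open>
  \<open>measure_of\<close> yields the given set function on the Borel sets of the sphere because that function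
  is countably additive there: the boundary points of a convex body with more than one outer unit
  normal form a null set for the \<open>(n-1)\<close>-dimensional Hausdorff measure.
\<close>

definition surface_area_measure :: "(real^'n) set \<Rightarrow> (real^'n) measure" where
  "surface_area_measure K =
     measure_of (sphere 0 1) (sets (restrict_space borel (sphere 0 1)))
       (\<lambda>A. hausdorff_measure (CARD('n) - 1)
              {x \<in> frontier K. \<exists>u\<in>A. outer_unit_normal K x u})"

definition Lp_mixed_volume :: "real \<Rightarrow> (real^'n) set \<Rightarrow> (real^'n) set \<Rightarrow> real" where
  "Lp_mixed_volume p K Q =
     1 / real CARD('n) *
       (\<integral>u. support_function Q u powr p * support_function K u powr (1 - p)
          \<partial>surface_area_measure K)"

definition p_surface_area :: "real \<Rightarrow> (real^'n) set \<Rightarrow> real" where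
  "p_surface_area p K = real CARD('n) * Lp_mixed_volume p K (cball 0 1)"

definition geominimal_functional :: "real \<Rightarrow> (real^'n) set \<Rightarrow> (real^'n) set \<Rightarrow> real" where
  "geominimal_functional p K Q =
     real CARD('n) * Lp_mixed_volume p K Q powr (real CARD('n) / (real CARD('n) + p))
       * measure lebesgue (polar_body Q) powr (p / (real CARD('n) + p))"

text \<open>
  The value is an extended real because the supremum may be infinite.
  The definition is meaningful only for \<open>p \<noteq> -n\<close>.
\<close>

definition Lp_geominimal :: "real \<Rightarrow> (real^'n) set \<Rightarrow> ereal" where
  "Lp_geominimal p K =
     (if p \<ge> 0 then INF Q\<in>convex_bodies0. ereal (geominimal_functional p K Q)
      else SUP Q\<in>convex_bodies0. ereal (geominimal_functional p K Q))"

end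

theory Submission
  imports Defs "HOL-Probability.Probability_Measure"
begin

text \<open>
  Both inequalities follow by testing the infimum (supremum) for \<open>K\<close> with the unit ball, once the ball
  is known to be extremal for itself. No information about the surface area measure of \<open>K\<close> is
  needed for this; for the ball, it has to be shown to be a positive finite multiple of the
  uniform measure \<open>\<sigma>\<close> on the sphere, the normalised cone measure. This multiple need not be computed, since it
  cancels. The Hausdorff measure is a metric outer measure, hence a Borel measure; it
  is orthogonally invariant, and packing and covering estimates bound its value on the sphere. Two
  probability measures on the sphere for which the measure of a ball does not depend on its
  centre coincide, which identifies it with \<open>\<sigma>\<close>. Finally, the polar body of \<open>Q\<close> has volume
  \<open>|B| \<integral> h^-n d\<sigma>\<close> for the support function \<open>h\<close> of \<open>Q\<close>, and Jensen's inequality for \<open>x \<mapsto> x powr (-p/n)\<close>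
  compares \<open>\<integral> h^p d\<sigma>\<close> with \<open>\<integral> h^-n d\<sigma>\<close>.
\<close>

subsection \<open>Hausdorff measure as a Borel measure\<close>

text \<open>\<open>measure_of\<close> yields the zero measure unless the given set function is
  countably additive, so no integral over the sphere can be evaluated before additivity is proved.
  For the ball every point of the sphere is its own unique normal, which turns the set function into
  the Hausdorff measure itself. Let I and J be the moments of the support function of Q of orders p
  and -n. The exponents a = n/(n+p) and b = p/(n+p) of the functional satisfy p a = n b, so I^a J^b
  does not change when Q is dilated. The exponent -p/n is the one that turns order -n into order p.
  The corresponding power is convex for p \<ge> 0 and for p < -n, and concave in between; as p
  passes -n, the sign of a changes as well. The two changes compensate, which is why one inequality
  holds for all p < 0 on both sides of the excluded value.\<close>

lemma hausdorff_premeasure_le: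
  assumes "A \<subseteq> (\<Union>i. U i)" "\<And>i. bounded (U i)" "\<And>i. diameter (U i) \<le> \<delta>"
  shows "hausdorff_premeasure d \<delta> A \<le> (\<Sum>i. hausdorff_weight d (U i))"
  unfolding hausdorff_premeasure_def using assms by (intro INF_lower) auto

lemma hausdorff_premeasure_lessE:
  assumes "hausdorff_premeasure d \<delta> A < c"
  obtains U where "A \<subseteq> (\<Union>i. U i)" "\<And>i. bounded (U i)" "\<And>i. diameter (U i) \<le> \<delta>"
    "(\<Sum>i. hausdorff_weight d (U i)) < c"
  using assms unfolding hausdorff_premeasure_def INF_less_iff by auto

lemma hausdorff_premeasure_greatest:
  assumes "\<And>U. A \<subseteq> (\<Union>i. U i) \<Longrightarrow> (\<And>i. bounded (U i)) \<Longrightarrow> (\<And>i. diameter (U i) \<le> \<delta>)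
             \<Longrightarrow> c \<le> (\<Sum>i. hausdorff_weight d (U i))"
  shows "c \<le> hausdorff_premeasure d \<delta> A"
  unfolding hausdorff_premeasure_def using assms by (intro INF_greatest) auto

lemma hausdorff_weight_empty [simp]: "hausdorff_weight d {} = 0"
  by (simp add: hausdorff_weight_def)

lemma hausdorff_premeasure_mono:
  assumes "A \<subseteq> B" shows "hausdorff_premeasure d \<delta> A \<le> hausdorff_premeasure d \<delta> B"
  using assms by (intro hausdorff_premeasure_greatest hausdorff_premeasure_le) auto

lemma hausdorff_premeasure_antimono:
  assumes "\<delta> \<le> \<epsilon>" shows "hausdorff_premeasure d \<epsilon> A \<le> hausdorff_premeasure d \<delta> A"
  using assms by (intro hausdorff_premeasure_greatest hausdorff_premeasure_le) (auto intro: order_trans)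

lemma hausdorff_premeasure_empty [simp]:
  assumes "\<delta> \<ge> 0" shows "hausdorff_premeasure d \<delta> {} = 0"
  using hausdorff_premeasure_le[of "{}" "\<lambda>_. {}" \<delta> d] assms by simp

text \<open>Covers of the \<open>A i\<close> that are optimal up to \<open>e * (1/2) ^ Suc i\<close>
  are merged into one sequence by \<open>prod_decode\<close>; the errors add up to
  \<open>e\<close>.\<close>

lemma hausdorff_premeasure_countably_subadditive:
  "hausdorff_premeasure d \<delta> (\<Union>i. A i) \<le> (\<Sum>i. hausdorff_premeasure d \<delta> (A i))"
proof (rule ennreal_le_epsilon)
  fix e :: real assume fin: "(\<Sum>i. hausdorff_premeasure d \<delta> (A i)) < top" and "e > 0"
  have "\<exists>U. A i \<subseteq> (\<Union>j. U j) \<and> (\<forall>j. bounded (U j)) \<and> (\<forall>j. diameter (U j) \<le> \<delta>) \<and>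
    (\<Sum>j. hausdorff_weight d (U j)) \<le> hausdorff_premeasure d \<delta> (A i) + e * (1/2) ^ Suc i" for i
  proof -
    \<comment> \<open>Adding a positive number to \<open>top\<close> gives no strict increase, so
      the finiteness granted by \<open>ennreal_le_epsilon\<close> is what produces a cover strictly
      below the enlarged value.\<close>
    have "hausdorff_premeasure d \<delta> (A i) < top"
      using fin ennreal_suminf_lessD by blast
    moreover have "(0::ennreal) < e * (1/2) ^ Suc i"
      using \<open>e > 0\<close> by (simp add: ennreal_less_zero_iff del: power_Suc)
    ultimately have "hausdorff_premeasure d \<delta> (A i) + 0 < hausdorff_premeasure d \<delta> (A i) + e * (1/2) ^ Suc i"
      unfolding ennreal_add_left_cancel_less by simp
    then have "hausdorff_premeasure d \<delta> (A i) < hausdorff_premeasure d \<delta> (A i) + e * (1/2) ^ Suc i"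
      by simp
    then obtain U where "A i \<subseteq> (\<Union>i. U i)" "\<And>i. bounded (U i)" "\<And>i. diameter (U i) \<le> \<delta>"
        "(\<Sum>j. hausdorff_weight d (U j)) < hausdorff_premeasure d \<delta> (A i) + e * (1/2) ^ Suc i"
      by (rule hausdorff_premeasure_lessE) blast
    then show ?thesis by (intro exI[of _ U]) auto
  qed
  then obtain U where U: "\<And>i. A i \<subseteq> (\<Union>j. U i j)" "\<And>i j. bounded (U i j)" "\<And>i j. diameter (U i j) \<le> \<delta>"
    and le: "\<And>i. (\<Sum>j. hausdorff_weight d (U i j)) \<le> hausdorff_premeasure d \<delta> (A i) + e * (1/2) ^ Suc i"
    by metis
  have "hausdorff_premeasure d \<delta> (\<Union>i. A i) \<le> (\<Sum>k. hausdorff_weight d (case_prod U (prod_decode k)))"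
  proof (rule hausdorff_premeasure_le)
    show "(\<Union>i. A i) \<subseteq> (\<Union>k. case_prod U (prod_decode k))"
    proof
      fix x assume "x \<in> (\<Union>i. A i)"
      then obtain i j where "x \<in> U i j" using U(1) by blast
      then show "x \<in> (\<Union>k. case_prod U (prod_decode k))"
        by (intro UN_I[of "prod_encode (i, j)"]) auto
    qed
  qed (auto split: prod.split simp: U)
  also have "\<dots> = (\<Sum>i. \<Sum>j. hausdorff_weight d (U i j))"
    by (rule suminf_ennreal_2dimen[where f="\<lambda>p. hausdorff_weight d (case_prod U p)"]) simp
  also have "\<dots> \<le> (\<Sum>i. hausdorff_premeasure d \<delta> (A i) + e * (1/2) ^ Suc i)"
    by (intro suminf_le le) auto
  also have "\<dots> = (\<Sum>i. hausdorff_premeasure d \<delta> (A i)) + (\<Sum>i. ennreal e * ennreal ((1/2) ^ Suc i))"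
    using \<open>0 < e\<close> by (subst suminf_add[symmetric])
      (auto simp del: ennreal_suminf_cmult simp add: ennreal_mult[symmetric])
  also have "\<dots> = (\<Sum>i. hausdorff_premeasure d \<delta> (A i)) + e"
    unfolding ennreal_suminf_cmult
    by (subst suminf_ennreal_eq[OF zero_le_power power_half_series]) auto
  finally show "hausdorff_premeasure d \<delta> (\<Union>i. A i) \<le> (\<Sum>i. hausdorff_premeasure d \<delta> (A i)) + e" .
qed

text \<open>A set of diameter at most \<delta> cannot meet both \<open>A\<close> and
  \<open>B\<close>, so every cover of the union contains two disjoint subfamilies covering
  \<open>A\<close> and \<open>B\<close>.\<close>

lemma hausdorff_premeasure_separated:
  assumes sep: "\<And>a b. a \<in> A \<Longrightarrow> b \<in> B \<Longrightarrow> \<delta> < dist a b"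
  shows "hausdorff_premeasure d \<delta> A + hausdorff_premeasure d \<delta> B \<le> hausdorff_premeasure d \<delta> (A \<union> B)"
proof (rule hausdorff_premeasure_greatest)
  fix U :: "nat \<Rightarrow> 'a set" assume U: "A \<union> B \<subseteq> (\<Union>i. U i)" "\<And>i. bounded (U i)" "\<And>i. diameter (U i) \<le> \<delta>"
  define V where "V C i = (if U i \<inter> C \<noteq> {} then U i else {})" for C :: "'a set" and i :: nat
  \<comment> \<open>Discarded members of the cover are replaced by the empty set, whose diameter 0
    must not exceed \<delta>; the given cover already forces this.\<close>
  have dpos: "0 \<le> \<delta>" using U(2,3) diameter_ge_0 order_trans by blast
  have pre: "hausdorff_premeasure d \<delta> C \<le> (\<Sum>i. hausdorff_weight d (V C i))" if sub: "C \<subseteq> A \<union> B" for C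
  proof (rule hausdorff_premeasure_le)
    show "C \<subseteq> (\<Union>i. V C i)"
    proof
      fix x assume "x \<in> C"
      then obtain i where "x \<in> U i" using sub U(1) by blast
      then show "x \<in> (\<Union>i. V C i)" using \<open>x \<in> C\<close> by (intro UN_I[of i]) (auto simp: V_def)
    qed
  qed (auto simp: V_def U dpos)
  have disj: "V A i = {} \<or> V B i = {}" for i
  proof (rule ccontr)
    assume "\<not> ?thesis"
    then obtain a b where "a \<in> U i" "a \<in> A" "b \<in> U i" "b \<in> B" by (auto simp: V_def split: if_splits)
    then have "dist a b \<le> diameter (U i)" "\<delta> < dist a b"
      using diameter_bounded_bound[OF U(2)] sep by auto
    then show False using U(3)[of i] by simp
  qed
  \<comment> \<open>At least one of the two sets is empty. The empty set has weight 0 for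
    \<open>d = 0\<close> too, thanks to the case distinction in
    \<open>hausdorff_weight\<close>.\<close>
  have "hausdorff_weight d (V A i) + hausdorff_weight d (V B i) \<le> hausdorff_weight d (U i)" for i
    using disj[of i] by (auto simp: V_def split: if_splits)
  then have "(\<Sum>i. hausdorff_weight d (V A i)) + (\<Sum>i. hausdorff_weight d (V B i)) \<le> (\<Sum>i. hausdorff_weight d (U i))"
    by (subst suminf_add) (auto intro!: suminf_le)
  then show "hausdorff_premeasure d \<delta> A + hausdorff_premeasure d \<delta> B \<le> (\<Sum>i. hausdorff_weight d (U i))"
    using add_mono[OF pre[of A] pre[of B]] by (auto intro: order_trans)
qed

lemma hausdorff_premeasure_le_measure:
  "\<delta> > 0 \<Longrightarrow> hausdorff_premeasure d \<delta> A \<le> hausdorff_measure d A"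
  unfolding hausdorff_measure_def by (intro SUP_upper) auto

lemma hausdorff_measure_empty [simp]: "hausdorff_measure d {} = 0"
  unfolding hausdorff_measure_def by (intro antisym SUP_least) auto

lemma hausdorff_measure_mono: "A \<subseteq> B \<Longrightarrow> hausdorff_measure d A \<le> hausdorff_measure d B"
  unfolding hausdorff_measure_def by (intro SUP_mono) (auto intro: hausdorff_premeasure_mono)

lemma hausdorff_measure_countably_subadditive:
  "hausdorff_measure d (\<Union>i. A i) \<le> (\<Sum>i. hausdorff_measure d (A i))"
  unfolding hausdorff_measure_def[of d "\<Union>i. A i"]
proof (rule SUP_least)
  fix \<delta> :: real assume "\<delta> \<in> {0<..}"
  then show "hausdorff_premeasure d \<delta> (\<Union>i. A i) \<le> (\<Sum>i. hausdorff_measure d (A i))"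
    by (intro order_trans[OF hausdorff_premeasure_countably_subadditive] suminf_le
        hausdorff_premeasure_le_measure) auto
qed

lemma hausdorff_outer_measure_space: "outer_measure_space (Pow UNIV) (hausdorff_measure d)"
  by (auto simp: outer_measure_space_def positive_def increasing_def countably_subadditive_def
      intro: hausdorff_measure_mono hausdorff_measure_countably_subadditive)

lemma hausdorff_measure_subadditive:
  "hausdorff_measure d (A \<union> B) \<le> hausdorff_measure d A + hausdorff_measure d B"
proof -
  have "hausdorff_measure d (\<Union>i. binaryset A B i) \<le> (\<Sum>i. hausdorff_measure d (binaryset A B i))"
    by (rule hausdorff_measure_countably_subadditive)
  then show ?thesis
    by (simp add: UN_binaryset_eq suminf_binaryset_eq)
qed

text \<open>This is the defining property of a metric outer measure. The premeasures grow as the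
  scale shrinks, so only scales below \<open>e\<close> matter, and the sum of the two suprema is the
  supremum of the sums.\<close>

lemma hausdorff_measure_separated:
  assumes "e > 0" and sep: "\<And>a b. a \<in> A \<Longrightarrow> b \<in> B \<Longrightarrow> e \<le> dist a b"
  shows "hausdorff_measure d (A \<union> B) = hausdorff_measure d A + hausdorff_measure d B"
proof (rule antisym[OF hausdorff_measure_subadditive])
  have mono: "hausdorff_premeasure d \<delta> C \<le> hausdorff_premeasure d (min \<delta> \<epsilon>) C"
             "hausdorff_premeasure d \<delta> C \<le> hausdorff_premeasure d (min \<epsilon> \<delta>) C" for \<delta> \<epsilon> and C :: "'a set"
    by (auto intro!: hausdorff_premeasure_antimono)
  have "hausdorff_measure d A + hausdorff_measure d B
     = (SUP \<delta>\<in>{0<..}. hausdorff_premeasure d \<delta> A + hausdorff_premeasure d \<delta> B)"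
    unfolding hausdorff_measure_def
  proof (rule SUP_add_directed_ennreal[symmetric])
    fix i j :: real assume "i \<in> {0<..}" "j \<in> {0<..}"
    then show "\<exists>k\<in>{0<..}. hausdorff_premeasure d i A + hausdorff_premeasure d j B
              \<le> hausdorff_premeasure d k A + hausdorff_premeasure d k B"
      using mono by (intro bexI[of _ "min i j"] add_mono) auto
  qed
  also have "\<dots> \<le> hausdorff_measure d (A \<union> B)"
  proof (rule SUP_least)
    fix \<delta> :: real assume "\<delta> \<in> {0<..}"
    \<comment> \<open>Half of \<open>e\<close>, because separation at a fixed scale is required to
      be strict.\<close>
    define \<epsilon> where "\<epsilon> = min \<delta> (e/2)"
    have \<epsilon>: "\<epsilon> > 0" "\<epsilon> \<le> \<delta>" "\<epsilon> < e" using \<open>\<delta> \<in> _\<close> \<open>e > 0\<close> by (auto simp: \<epsilon>_def)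
    have "hausdorff_premeasure d \<delta> A + hausdorff_premeasure d \<delta> B
       \<le> hausdorff_premeasure d \<epsilon> A + hausdorff_premeasure d \<epsilon> B"
      using \<epsilon> by (intro add_mono hausdorff_premeasure_antimono)
    also have "\<dots> \<le> hausdorff_premeasure d \<epsilon> (A \<union> B)"
      using \<epsilon>(3) sep by (intro hausdorff_premeasure_separated) fastforce
    also have "\<dots> \<le> hausdorff_measure d (A \<union> B)"
      using \<epsilon> by (intro hausdorff_premeasure_le_measure)
    finally show "hausdorff_premeasure d \<delta> A + hausdorff_premeasure d \<delta> B \<le> hausdorff_measure d (A \<union> B)" .
  qed
  finally show "hausdorff_measure d A + hausdorff_measure d B \<le> hausdorff_measure d (A \<union> B)" .
qed

text \<open>The gap \<open>e j\<close> may tend to 0 with \<open>j\<close>: in the induction the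
  newest set only has to keep away from the union of its predecessors.\<close>

lemma hausdorff_measure_separated_sum:
  fixes B :: "nat \<Rightarrow> 'a::metric_space set"
  assumes "\<And>i. e i > 0"
    and "\<And>i j a b. i < j \<Longrightarrow> a \<in> B i \<Longrightarrow> b \<in> B j \<Longrightarrow> e j \<le> dist a b"
  shows "(\<Sum>i<n. hausdorff_measure d (B i)) = hausdorff_measure d (\<Union>i<n. B i)"
proof (induction n)
  case (Suc n)
  have "hausdorff_measure d ((\<Union>i<n. B i) \<union> B n) = hausdorff_measure d (\<Union>i<n. B i) + hausdorff_measure d (B n)"
    using assms by (intro hausdorff_measure_separated[of "e n"]) auto
  then show ?case using Suc by (simp add: lessThan_Suc Un_commute)
qed simp

text \<open>
  Caratheodory's criterion. In the proof, the rings \<open>R k\<close> around \<open>F\<close> whose indices have the same parity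
  are separated from each other, so that their measures are summable.
\<close>
lemma closed_in_hausdorff_lambda_system:
  fixes F :: "'a::metric_space set"
  assumes "closed F"
  shows "F \<in> lambda_system UNIV (Pow UNIV) (hausdorff_measure d)"
proof (cases "F = {}")
  case True
  then show ?thesis by (simp add: lambda_system_def)
next
  case ne: False
  let ?H = "hausdorff_measure d :: 'a set \<Rightarrow> ennreal"
  have "?H (F \<inter> A) + ?H (A - F) \<le> ?H A" if fin: "?H A < top" for A
  proof -
    \<comment> \<open>\<open>D k\<close> has positive distance from \<open>F\<close>, so additivity
      is known for \<open>F \<inter> A\<close> and \<open>D k\<close>. The rings of index at least
      \<open>k\<close> cover the rest of \<open>A - F\<close>, and the sum of their measures tends
      to 0.\<close>
    define D where "D k = {x\<in>A. 1 / real (Suc k) \<le> infdist x F}" for k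
    define R where "R k = {x\<in>A. 1 / real (Suc (Suc k)) \<le> infdist x F \<and> infdist x F < 1 / real (Suc k)}" for k
    have sep: "1 / real (Suc (Suc (Suc i))) - 0 < 1 / real (Suc (Suc i))" for i by (simp add: field_simps)
    have Rsum: "(\<Sum>j. ?H (R (2 * j + c))) \<le> ?H A" for c
    proof (rule suminf_le_const[OF summableI])
      fix n
      \<comment> \<open>The ring of index \<open>2 * j + c\<close> lies closer to \<open>F\<close>
        than \<open>1 / (2 * j + c + 1)\<close>, the earlier rings of this parity no closer than
        \<open>1 / (2 * j + c)\<close>. For \<open>j = 0\<close> there are no earlier rings, and
        truncated subtraction can make \<open>e 0\<close> vanish; hence the dummy gap 1.\<close>
      define e where "e j = 1 / real (Suc (2 * j + c - 1)) - 1 / real (Suc (2*j + c))" for j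
      have pos: "(if j = 0 then 1 else e j) > 0" for j
        by (auto simp: e_def intro!: divide_strict_left_mono)
      have "(\<Sum>j<n. ?H (R (2 * j + c))) = ?H (\<Union>j<n. R (2 * j + c))"
      proof (rule hausdorff_measure_separated_sum[where e="\<lambda>j. if j = 0 then 1 else e j"])
        fix i j a b assume "i < j" and a: "a \<in> R (2 * i + c)" and b: "b \<in> R (2 * j + c)"
        have "infdist a F \<le> infdist b F + dist a b" by (rule infdist_triangle)
        moreover have "1 / real (Suc (2 * j + c - 1)) \<le> 1 / real (Suc (Suc (2 * i + c)))"
          using \<open>i < j\<close> by (intro divide_left_mono) auto
        ultimately show "(if j = 0 then 1 else e j) \<le> dist a b" using a b \<open>i < j\<close> by (auto simp: R_def e_def)
      qed (rule pos)
      also have "\<dots> \<le> ?H A" by (rule hausdorff_measure_mono) (auto simp: R_def)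
      finally show "(\<Sum>j<n. ?H (R (2 * j + c))) \<le> ?H A" .
    qed
    have "(\<Sum>k. ?H (R k)) \<le> 2 * ?H A"
    proof (rule suminf_le_const[OF summableI])
      fix n
      have "(\<Sum>k<n. ?H (R k)) \<le> (\<Sum>k<2*n. ?H (R k))" by (rule sum_mono2) auto
      also have "\<dots> = (\<Sum>j<n. ?H (R (2*j+0))) + (\<Sum>j<n. ?H (R (2*j+1)))"
        by (induction n) (auto simp: algebra_simps)
      also have "\<dots> \<le> (\<Sum>j. ?H (R (2*j+0))) + (\<Sum>j. ?H (R (2*j+1)))"
        by (intro add_mono sum_le_suminf) auto
      also have "\<dots> \<le> ?H A + ?H A" by (intro add_mono Rsum)
      finally show "(\<Sum>k<n. ?H (R k)) \<le> 2 * ?H A" by (simp add: mult_2)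
    qed
    then have Rfin: "(\<Sum>k. ?H (R k)) \<noteq> top"
      using fin by (metis ennreal_mult_less_top ennreal_numeral_less_top leD top.not_eq_extremum)
    have AF: "?H (A - F) \<le> ?H (D k) + (\<Sum>j. ?H (R (j + k)))" for k
    proof -
      have "A - F \<subseteq> D k \<union> (\<Union>j. R (j + k))"
      proof
        fix x assume x: "x \<in> A - F"
        \<comment> \<open>Closedness of \<open>F\<close> enters here: a positive distance from
          \<open>F\<close> places the point in \<open>D k\<close> or in one of the rings.\<close>
        then have "infdist x F > 0"
          using assms ne infdist_pos_not_in_closed by auto
        then obtain m where m: "1 / real (Suc m) \<le> infdist x F"
          using reals_Archimedean by (metis inverse_eq_divide less_imp_le)
        define l where "l = (LEAST m. 1 / real (Suc m) \<le> infdist x F)"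
        have l: "1 / real (Suc l) \<le> infdist x F" unfolding l_def by (rule LeastI[of _ m]) (rule m)
        show "x \<in> D k \<union> (\<Union>j. R (j + k))"
        proof (cases "l \<le> k")
          case True
          then have "1 / real (Suc k) \<le> 1 / real (Suc l)" by (intro divide_left_mono) auto
          then show ?thesis using l x by (auto simp: D_def)
        next
          case False
          define j where "j = l - 1 - k"
          have lj: "l = Suc (j + k)" using False by (simp add: j_def)
          have "\<not> 1 / real (Suc (j + k)) \<le> infdist x F"
            using not_less_Least[of "j + k" "\<lambda>m. 1 / real (Suc m) \<le> infdist x F"] lj l_def by simp
          then have "x \<in> R (j + k)" using l x lj by (auto simp: R_def)
          then show ?thesis by auto
        qed
      qed
      then have "?H (A - F) \<le> ?H (D k \<union> (\<Union>j. R (j + k)))" by (rule hausdorff_measure_mono)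
      also have "\<dots> \<le> ?H (D k) + ?H (\<Union>j. R (j + k))" by (rule hausdorff_measure_subadditive)
      also have "\<dots> \<le> ?H (D k) + (\<Sum>j. ?H (R (j + k)))"
        by (intro add_left_mono hausdorff_measure_countably_subadditive)
      finally show ?thesis .
    qed
    have "?H (F \<inter> A) + ?H (A - F) \<le> ?H A + (\<Sum>j. ?H (R (j + k)))" for k
    proof -
      have "?H (F \<inter> A) + ?H (D k) = ?H ((F \<inter> A) \<union> D k)"
      proof (rule hausdorff_measure_separated[symmetric])
        fix a b assume "a \<in> F \<inter> A" "b \<in> D k"
        then have "infdist b F \<le> dist b a" "1 / real (Suc k) \<le> infdist b F" by (auto simp: D_def infdist_le)
        then show "1 / real (Suc k) \<le> dist a b" by (simp add: dist_commute)
      qed simp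
      also have "\<dots> \<le> ?H A" by (rule hausdorff_measure_mono) (auto simp: D_def)
      finally have "?H (F \<inter> A) + ?H (D k) + (\<Sum>j. ?H (R (j + k))) \<le> ?H A + (\<Sum>j. ?H (R (j + k)))"
        by (rule add_right_mono)
      moreover have "?H (F \<inter> A) + ?H (A - F) \<le> ?H (F \<inter> A) + (?H (D k) + (\<Sum>j. ?H (R (j + k))))"
        by (rule add_left_mono[OF AF])
      ultimately show ?thesis unfolding add.assoc by (rule order_trans[rotated])
    qed
    moreover have "(\<lambda>k. ?H A + (\<Sum>j. ?H (R (j + k)))) \<longlonglongrightarrow> ?H A + 0"
    proof (intro tendsto_add tendsto_const)
      have 1: "(\<Sum>j. ?H (R j)) = (\<Sum>j. ?H (R (j + k))) + (\<Sum>j<k. ?H (R j))" for k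
        by (rule suminf_offset) auto
      have "(\<lambda>k. (\<Sum>j. ?H (R j)) - (\<Sum>j<k. ?H (R j))) \<longlonglongrightarrow> (\<Sum>j. ?H (R j)) - (\<Sum>j. ?H (R j))"
        using Rfin by (intro tendsto_diff_ennreal_general tendsto_const summable_LIMSEQ) auto
      moreover have "(\<Sum>j. ?H (R j)) - (\<Sum>j<k. ?H (R j)) = (\<Sum>j. ?H (R (j + k)))" for k
      proof -
        have "(\<Sum>j<k. ?H (R j)) \<noteq> top" using Rfin 1[of k] by auto
        then show ?thesis by (subst 1[of k]) simp
      qed
      ultimately show "(\<lambda>k. (\<Sum>j. ?H (R (j + k)))) \<longlonglongrightarrow> 0" using Rfin by simp
    qed
    ultimately show ?thesis using LIMSEQ_le_const by fastforce
  qed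
  then have "?H (F \<inter> A) + ?H (A - F) \<le> ?H A" for A
    by (cases "?H A < top") (auto simp: not_less top_unique)
  moreover have "?H A \<le> ?H (F \<inter> A) + ?H (A - F)" for A
    using hausdorff_measure_subadditive[of d "F \<inter> A" "A - F"] by (simp add: Int_commute Int_Diff_Un)
  ultimately have "?H (F \<inter> A) + ?H (A - F) = ?H A" for A by (intro antisym)
  moreover have "(UNIV - F) \<inter> A = A - F" for A by auto
  ultimately show ?thesis by (auto simp: lambda_system_def)
qed

text \<open>An outer measure is countably additive on its Caratheodory sets. They form a
  sigma-algebra which contains the closed sets, hence all Borel sets.\<close>

lemma measure_space_hausdorff: "measure_space UNIV (sets borel) (hausdorff_measure d :: 'a::metric_space set \<Rightarrow> ennreal)"
proof -
  let ?L = "lambda_system UNIV (Pow UNIV) (hausdorff_measure d) :: 'a set set"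
  have ms: "measure_space UNIV ?L (hausdorff_measure d)"
    using sigma_algebra.caratheodory_lemma[OF sigma_algebra_Pow hausdorff_outer_measure_space[where d=d]] .
  then have sa: "sigma_algebra UNIV ?L" by (simp add: measure_space_def)
  have "sets borel \<subseteq> ?L"
    unfolding borel_eq_closed using sa closed_in_hausdorff_lambda_system
    by (simp add: sets_measure_of) (intro sigma_algebra.sigma_sets_subset, auto)
  then show ?thesis
    using measure_down[OF ms] by (metis sets.sigma_algebra_axioms space_borel)
qed

subsection \<open>The Hausdorff measure of the sphere\<close>

lemma diameter_isometric_image:
  assumes "\<And>x y. dist (f x) (f y) = dist x y"
  shows "diameter (f ` S) = diameter S"
proof -
  have "(\<lambda>(x, y). dist x y) ` (f ` S \<times> f ` S) = (\<lambda>(x, y). dist x y) ` (S \<times> S)"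
  proof -
    have "(\<lambda>(x, y). dist x y) ` (f ` S \<times> f ` S) = (\<lambda>(x, y). dist x y) ` (\<lambda>(x, y). (f x, f y)) ` (S \<times> S)"
      by (rule arg_cong[where f="image _"]) auto
    then show ?thesis by (simp add: image_image case_prod_unfold assms)
  qed
  then show ?thesis by (simp add: diameter_def)
qed

lemma hausdorff_measure_isometric_image_le:
  fixes f :: "'a::metric_space \<Rightarrow> 'b::metric_space"
  assumes iso: "\<And>x y. dist (f x) (f y) = dist x y"
  shows "hausdorff_measure d (f ` A) \<le> hausdorff_measure d A"
  unfolding hausdorff_measure_def
proof (intro SUP_mono bexI, rule hausdorff_premeasure_greatest)
  fix \<delta> and U :: "nat \<Rightarrow> 'a set"
  assume U: "A \<subseteq> (\<Union>i. U i)" "\<And>i. bounded (U i)" "\<And>i. diameter (U i) \<le> \<delta>"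
  have "bounded (f ` U i)" for i
  proof -
    obtain x e where "\<forall>y\<in>U i. dist x y \<le> e" using U(2)[of i] unfolding bounded_def by blast
    then show ?thesis unfolding bounded_def by (intro exI[of _ "f x"] exI[of _ e]) (auto simp: iso)
  qed
  then have "hausdorff_premeasure d \<delta> (f ` A) \<le> (\<Sum>i. hausdorff_weight d (f ` U i))"
    using image_mono[OF U(1), of f] U(3)
    by (intro hausdorff_premeasure_le) (simp_all add: image_UN diameter_isometric_image[OF iso])
  then show "hausdorff_premeasure d \<delta> (f ` A) \<le> (\<Sum>i. hausdorff_weight d (U i))"
    unfolding hausdorff_weight_def diameter_isometric_image[OF iso] image_is_empty .
qed

lemma hausdorff_measure_orthogonal_image:
  fixes f :: "'a::euclidean_space \<Rightarrow> 'a"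
  assumes f: "orthogonal_transformation f"
  shows "hausdorff_measure d (f ` A) = hausdorff_measure d A"
proof (rule antisym)
  show "hausdorff_measure d (f ` A) \<le> hausdorff_measure d A"
    using f by (intro hausdorff_measure_isometric_image_le) (auto simp: orthogonal_transformation_isometry)
  have "hausdorff_measure d (inv f ` f ` A) \<le> hausdorff_measure d (f ` A)"
    using orthogonal_transformation_inv[OF f]
    by (intro hausdorff_measure_isometric_image_le) (auto simp: orthogonal_transformation_isometry)
  then show "hausdorff_measure d A \<le> hausdorff_measure d (f ` A)"
    using orthogonal_transformation_inj[OF f] by (simp add: image_inv_f_f)
qed

lemma hausdorff_premeasure_le_finite:
  fixes A :: "'a::metric_space set"
  assumes P: "finite P" and "A \<subseteq> (\<Union>x\<in>P. U x)" "\<And>x. bounded (U x)" "\<And>x. diameter (U x) \<le> \<delta>" "\<delta> \<ge> 0"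
  shows "hausdorff_premeasure d \<delta> A \<le> (\<Sum>x\<in>P. hausdorff_weight d (U x))"
proof -
  obtain h where h: "bij_betw h {..<card P} P"
    using ex_bij_betw_nat_finite[OF P] by (auto simp: atLeast0LessThan)
  define V where "V i = (if i < card P then U (h i) else {})" for i
  have "A \<subseteq> (\<Union>i. V i)"
  proof
    fix a assume "a \<in> A"
    then obtain x where x: "x \<in> P" "a \<in> U x" using assms(2) by blast
    then obtain i where "i < card P" "h i = x"
      using bij_betw_imp_surj_on[OF h] by (metis imageE lessThan_iff)
    then have "a \<in> V i" using x by (simp add: V_def)
    then show "a \<in> (\<Union>i. V i)" by blast
  qed
  then have "hausdorff_premeasure d \<delta> A \<le> (\<Sum>i. hausdorff_weight d (V i))"
    using assms(3-) by (intro hausdorff_premeasure_le) (simp_all add: V_def)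
  also have "\<dots> = (\<Sum>i<card P. hausdorff_weight d (V i))"
    by (rule suminf_finite) (auto simp: V_def)
  also have "\<dots> = (\<Sum>i<card P. hausdorff_weight d (U (h i)))" by (simp add: V_def)
  also have "\<dots> = (\<Sum>x\<in>P. hausdorff_weight d (U x))" by (rule sum.reindex_bij_betw[OF h])
  finally show ?thesis .
qed

section \<open>Packing and covering of the sphere\<close>

lemma power_diff_le:
  fixes a b :: real
  assumes "0 \<le> a" "a \<le> b" "b \<le> 2"
  shows "b ^ n - a ^ n \<le> real n * 2 ^ n * (b - a)"
proof (induction n)
  case (Suc n)
  have "b ^ Suc n - a ^ Suc n = b * (b ^ n - a ^ n) + (b - a) * a ^ n" by (simp add: algebra_simps)
  also have "\<dots> \<le> 2 * (real n * 2 ^ n * (b - a)) + (b - a) * 2 ^ n"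
    using assms Suc by (intro add_mono mult_mono power_mono) (auto simp: power_mono)
  also have "\<dots> \<le> real (Suc n) * 2 ^ Suc n * (b - a)"
    using assms by (simp add: algebra_simps mult_left_mono)
  finally show ?case .
qed simp

lemma emeasure_ball_ne_top: "emeasure lborel (ball (c::'a::euclidean_space) r) \<noteq> top"
  using emeasure_lborel_ball_finite[of c r] by simp

lemma emeasure_ball_neq_0:
  assumes "r > 0" shows "emeasure lborel (ball (c::'a::euclidean_space) r) \<noteq> 0"
proof -
  have "unit_ball_vol (real DIM('a)) * r ^ DIM('a) > 0" using assms by simp
  then have "ennreal (unit_ball_vol (real DIM('a)) * r ^ DIM('a)) \<noteq> 0"
    by (simp only: ennreal_eq_0_iff not_le)
  then show ?thesis using emeasure_ball[of r c] assms by simp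
qed

text \<open>The balls of radius \<open>\<delta>/2\<close> around \<open>P\<close> are disjoint and
  lie in a shell of thickness \<delta>, whose volume is at most linear in \<delta> by
  \<open>power_diff_le\<close>. Each ball has volume proportional to
  \<open>\<delta> ^ DIM('a)\<close>, so one power cancels. Of the factor \<open>4 ^ DIM('a)\<close>,
  one half of the exponent comes from \<open>power_diff_le\<close> and the other from halving the
  radius.\<close>

lemma separated_sphere_card_le:
  fixes P :: "'a::euclidean_space set"
  assumes P: "finite P" "P \<subseteq> sphere 0 1" and sep: "\<And>x y. x \<in> P \<Longrightarrow> y \<in> P \<Longrightarrow> x \<noteq> y \<Longrightarrow> \<delta> \<le> dist x y"
    and \<delta>: "0 < \<delta>" "\<delta> \<le> 1"
  shows "real (card P) * \<delta> ^ (DIM('a) - 1) \<le> real DIM('a) * 4 ^ DIM('a)"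
proof -
  let ?n = "DIM('a)" and ?w = "unit_ball_vol (real DIM('a))"
  have w: "?w > 0" by simp
  have disj: "disjoint_family_on (\<lambda>x. ball x (\<delta>/2)) P"
    unfolding disjoint_family_on_def
  proof (intro ballI impI)
    fix x y assume "x \<in> P" "y \<in> P" "x \<noteq> y"
    then show "ball x (\<delta>/2) \<inter> ball y (\<delta>/2) = {}"
      using sep[of x y] by (intro disjoint_ballI) auto
  qed
  have "real (card P) * (?w * (\<delta>/2) ^ ?n) = (\<Sum>x\<in>P. measure lborel (ball x (\<delta>/2)))"
    using \<delta> by (simp add: content_ball)
  also have "\<dots> = measure lborel (\<Union>x\<in>P. ball x (\<delta>/2))"
    using P disj by (intro measure_finite_Union[symmetric]) (auto simp: emeasure_ball_ne_top)
  also have "\<dots> \<le> measure lborel (ball (0::'a) (1 + \<delta>/2) - ball 0 (1 - \<delta>/2))"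
  proof (rule measure_mono_fmeasurable)
    show "(\<Union>x\<in>P. ball x (\<delta>/2)) \<subseteq> ball 0 (1 + \<delta>/2) - ball 0 (1 - \<delta>/2)"
    proof
      fix y assume "y \<in> (\<Union>x\<in>P. ball x (\<delta>/2))"
      then obtain x where "x \<in> P" "norm (x - y) < \<delta>/2" by (auto simp: dist_norm)
      moreover have "norm x = 1" using \<open>x \<in> P\<close> P by auto
      moreover have "norm x - norm y \<le> norm (x - y)" "norm y - norm x \<le> norm (x - y)"
        using norm_triangle_ineq3[of x y] by auto
      ultimately show "y \<in> ball 0 (1 + \<delta>/2) - ball 0 (1 - \<delta>/2)" by auto
    qed
    show "ball (0::'a) (1 + \<delta>/2) - ball 0 (1 - \<delta>/2) \<in> fmeasurable lborel"
      by (intro fmeasurable_Diff) (auto simp: fmeasurable_def emeasure_ball_ne_top simp flip: top.not_eq_extremum)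
  qed (use P(1) in auto)
  also have "\<dots> = measure lborel (ball (0::'a) (1 + \<delta>/2)) - measure lborel (ball (0::'a) (1 - \<delta>/2))"
    using \<delta> by (intro measure_Diff) (auto simp: emeasure_ball_ne_top subset_ball)
  also have "\<dots> = ?w * ((1 + \<delta>/2) ^ ?n - (1 - \<delta>/2) ^ ?n)"
    using \<delta> by (simp add: content_ball right_diff_distrib)
  also have "\<dots> \<le> ?w * (real ?n * 2 ^ ?n * ((1 + \<delta>/2) - (1 - \<delta>/2)))"
    using \<delta> w by (intro mult_left_mono power_diff_le) auto
  finally have "real (card P) * (\<delta>/2) ^ ?n \<le> real ?n * 2 ^ ?n * \<delta>"
    using w by (simp add: mult.left_commute)
  then have "real (card P) * \<delta> ^ ?n \<le> real ?n * 4 ^ ?n * \<delta>"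
  proof -
    have "(4::real) ^ ?n = 2 ^ ?n * 2 ^ ?n" by (simp flip: power_mult_distrib)
    moreover assume "real (card P) * (\<delta>/2) ^ ?n \<le> real ?n * 2 ^ ?n * \<delta>"
    then have "real (card P) * \<delta> ^ ?n \<le> (real ?n * 2 ^ ?n * \<delta>) * 2 ^ ?n"
      by (simp add: power_divide pos_divide_le_eq)
    ultimately show ?thesis by (simp add: mult_ac)
  qed
  moreover have "\<delta> ^ ?n = \<delta> ^ (?n - 1) * \<delta>"
    by (metis DIM_positive One_nat_def Suc_pred mult.commute power_Suc)
  ultimately show ?thesis using \<delta> by simp
qed

text \<open>A separated set of largest cardinality is a net, since any uncovered point could be
  added to it. The packing bound shows that a largest one exists and also bounds its size.\<close>

lemma sphere_finite_net:
  fixes \<delta> :: real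
  assumes \<delta>: "0 < \<delta>" "\<delta> \<le> 1"
  obtains P :: "'a::euclidean_space set" where "finite P" "sphere 0 1 \<subseteq> (\<Union>x\<in>P. ball x \<delta>)"
    "real (card P) * \<delta> ^ (DIM('a) - 1) \<le> real DIM('a) * 4 ^ DIM('a)"
proof -
  define Q where "Q P \<longleftrightarrow> finite P \<and> P \<subseteq> sphere 0 1 \<and> (\<forall>x\<in>P. \<forall>y\<in>P. x \<noteq> y \<longrightarrow> \<delta> \<le> dist x y)" for P :: "'a set"
  have bound: "real (card P) * \<delta> ^ (DIM('a) - 1) \<le> real DIM('a) * 4 ^ DIM('a)" if "Q P" for P :: "'a set"
  proof (rule separated_sphere_card_le)
    show "\<delta> \<le> dist x y" if "x \<in> P" "y \<in> P" "x \<noteq> y" for x y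
      using \<open>Q P\<close> that unfolding Q_def by blast
  qed (use that \<delta> in \<open>simp_all add: Q_def\<close>)
  have "card P \<le> nat \<lceil>real DIM('a) * 4 ^ DIM('a) / \<delta> ^ (DIM('a) - 1)\<rceil>" if "Q P" for P :: "'a set"
  proof -
    have "real (card P) \<le> real DIM('a) * 4 ^ DIM('a) / \<delta> ^ (DIM('a) - 1)"
      using bound[OF that] \<delta> by (simp add: pos_le_divide_eq)
    also note real_nat_ceiling_ge
    finally show ?thesis by (simp only: of_nat_le_iff)
  qed
  moreover have "Q {}" by (simp add: Q_def)
  ultimately have "\<exists>P. Q P \<and> (\<forall>P'. Q P' \<longrightarrow> card P' \<le> card P)"
    by (intro ex_has_greatest_nat[of Q "{}" card "Suc (nat \<lceil>real DIM('a) * 4 ^ DIM('a) / \<delta> ^ (DIM('a) - 1)\<rceil>)"])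
      (simp_all only: less_Suc_eq_le, simp_all)
  then obtain P where P: "Q P" "\<And>P'. Q P' \<Longrightarrow> card P' \<le> card P" by blast
  have "sphere 0 1 \<subseteq> (\<Union>x\<in>P. ball x \<delta>)"
  proof (rule ccontr)
    assume "\<not> ?thesis"
    then obtain z where z0: "z \<in> sphere 0 1" "z \<notin> (\<Union>x\<in>P. ball x \<delta>)" by blast
    then have z: "\<delta> \<le> dist x z" "\<delta> \<le> dist z x" if "x \<in> P" for x
      using that by (force simp: dist_commute)+
    have "z \<notin> P" using z(1)[of z] \<delta> by auto
    have "Q (insert z P)" using P(1) z0(1) z unfolding Q_def by blast
    then have "card (insert z P) \<le> card P" by (rule P(2))
    then show False using \<open>z \<notin> P\<close> P(1) by (simp add: Q_def)
  qed
  moreover have "finite P" using P(1) by (simp add: Q_def)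
  ultimately show ?thesis using bound[OF P(1)] by (intro that)
qed

lemma hausdorff_measure_sphere_finite:
  "hausdorff_measure (DIM('a) - 1) (sphere (0::'a::euclidean_space) 1) < top"
proof -
  let ?d = "DIM('a) - 1"
  define C where "C = unit_ball_vol (real ?d) * (real DIM('a) * 4 ^ DIM('a))"
  have "hausdorff_premeasure ?d \<delta> (sphere (0::'a) 1) \<le> ennreal C" if "\<delta> > 0" for \<delta>
  proof -
    \<comment> \<open>Balls of radius at most \<open>\<delta>/2\<close> have admissible diameter;
      the cap 1 is imposed by the net lemma. The resulting bound \<open>C\<close> is the same for
      every \<delta>.\<close>
    define e where "e = min (\<delta>/2) 1"
    have e: "0 < e" "e \<le> 1" "2 * e \<le> \<delta>" using that by (auto simp: e_def)
    obtain P :: "'a set" where P: "finite P" "sphere 0 1 \<subseteq> (\<Union>x\<in>P. ball x e)"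
      "real (card P) * e ^ ?d \<le> real DIM('a) * 4 ^ DIM('a)" by (rule sphere_finite_net[OF e(1,2)])
    have "hausdorff_premeasure ?d \<delta> (sphere (0::'a) 1) \<le> (\<Sum>x\<in>P. hausdorff_weight ?d (ball x e))"
      using P e that by (intro hausdorff_premeasure_le_finite) auto
    also have "\<dots> = (\<Sum>x\<in>P. ennreal (unit_ball_vol (real ?d) * e ^ ?d))"
      using e by (simp add: hausdorff_weight_def)
    also have "\<dots> = ennreal (\<Sum>x\<in>P. unit_ball_vol (real ?d) * e ^ ?d)"
      using e by (intro sum_ennreal) auto
    also have "\<dots> = ennreal (unit_ball_vol (real ?d) * (real (card P) * e ^ ?d))"
      by (simp add: mult.left_commute)
    also have "\<dots> \<le> ennreal C"
      unfolding C_def using P(3) by (intro ennreal_leI mult_left_mono) auto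
    finally show ?thesis .
  qed
  then have "hausdorff_measure ?d (sphere (0::'a) 1) \<le> ennreal C"
    unfolding hausdorff_measure_def by (intro SUP_least) auto
  then show ?thesis by (rule order_le_less_trans) simp
qed

section \<open>Lower bound for the Hausdorff measure of the sphere\<close>

lemma borel_measurable_sgn_euclidean [measurable]:
  "(sgn :: 'a::euclidean_space \<Rightarrow> 'a) \<in> borel_measurable borel"
  unfolding sgn_div_norm[abs_def] by measurable

text \<open>The truncated cone around the ray through \<open>x\<close> is covered by about
  \<open>1/d\<close> balls of radius \<open>2 * d\<close>, centred on the ray at multiples of
  \<open>d\<close>. Their volumes of order \<open>d ^ DIM('a)\<close> add up to order
  \<open>d ^ (DIM('a) - 1)\<close>.\<close>

lemma emeasure_shell_cone_le:
  fixes x :: "'a::euclidean_space"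
  assumes x: "norm x = 1" and d: "0 < d" "d \<le> 1"
  shows "emeasure lborel {z. 1/2 \<le> norm z \<and> norm z \<le> 1 \<and> dist x (sgn z) \<le> d}
     \<le> ennreal (unit_ball_vol (real DIM('a)) * 2 ^ Suc DIM('a) * d ^ (DIM('a) - 1))"
proof -
  let ?n = "DIM('a)" and ?w = "unit_ball_vol (real DIM('a))"
  define m where "m = nat \<lfloor>1/d\<rfloor>"
  have m: "real m \<le> 1/d" using d by (simp add: m_def)
  let ?T = "{z. 1/2 \<le> norm z \<and> norm z \<le> 1 \<and> dist x (sgn z) \<le> d}"
  have "?T \<subseteq> (\<Union>k\<le>m. cball ((real k * d) *\<^sub>R x) (2 * d))"
  proof
    fix z assume z: "z \<in> ?T"
    define k where "k = nat \<lfloor>norm z / d\<rfloor>"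
    have k0: "real k \<le> norm z / d" "norm z / d < real k + 1"
      using d by (auto simp: k_def)
    have "k \<le> m" unfolding k_def m_def using z d by (intro nat_mono floor_mono divide_right_mono) auto
    have k: "real k * d \<le> norm z" "norm z < real k * d + d"
      using k0 d by (auto simp: field_simps)
    have "norm z *\<^sub>R sgn z = z" by (cases "z = 0") (simp_all add: sgn_div_norm)
    \<comment> \<open>The error splits into a part across the ray, at most
      \<open>norm z * d\<close>, and a part along the ray, at most \<open>d\<close> by the choice of
      \<open>k\<close>.\<close>
    then have "(real k * d) *\<^sub>R x - z = norm z *\<^sub>R (x - sgn z) - (norm z - real k * d) *\<^sub>R x"
      by (simp add: algebra_simps)
    then have "norm ((real k * d) *\<^sub>R x - z) \<le> norm z * norm (x - sgn z) + \<bar>norm z - real k * d\<bar> * norm x"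
      by (metis abs_norm_cancel norm_scaleR norm_triangle_ineq4)
    also have "\<dots> \<le> 1 * d + d * 1"
      using z k x by (intro add_mono mult_mono) (auto simp: dist_norm)
    finally show "z \<in> (\<Union>k\<le>m. cball ((real k * d) *\<^sub>R x) (2 * d))"
      using \<open>k \<le> m\<close> by (intro UN_I[of k]) (auto simp: dist_norm)
  qed
  then have "emeasure lborel ?T \<le> emeasure lborel (\<Union>k\<le>m. cball ((real k * d) *\<^sub>R x) (2 * d))"
    by (intro emeasure_mono) auto
  also have "\<dots> \<le> (\<Sum>k\<le>m. emeasure lborel (cball ((real k * d) *\<^sub>R x) (2 * d)))"
    by (intro emeasure_subadditive_finite) auto
  also have "\<dots> = ennreal ((real m + 1) * (?w * (2 * d) ^ ?n))"
    using d by (simp add: emeasure_cball ennreal_mult ennreal_of_nat_eq_real_of_nat add.commute flip: ennreal_1 ennreal_plus)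
  also have "\<dots> \<le> ennreal ((2/d) * (?w * (2 * d) ^ ?n))"
  proof (intro ennreal_leI mult_right_mono)
    have "1 \<le> 1/d" using d by simp
    with m show "real m + 1 \<le> 2/d" by simp
  qed (use d in auto)
  also have "(2/d) * (?w * (2 * d) ^ ?n) = ?w * 2 ^ Suc ?n * d ^ (?n - 1)"
  proof -
    have "d ^ ?n = d ^ (?n - 1) * d"
      by (metis DIM_positive One_nat_def Suc_pred mult.commute power_Suc)
    then show ?thesis using d by (simp add: power_mult_distrib)
  qed
  finally show ?thesis .
qed

text \<open>A cover of the sphere by \<open>U i\<close> induces a cover of the shell
  \<open>S\<close> by the cones \<open>T i\<close> over these sets. The volume of such a cone is at
  most a constant times the weight of \<open>U i\<close>, so the positive volume of \<open>S\<close>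
  bounds the sum of the weights from below.\<close>

lemma hausdorff_measure_sphere_pos:
  "0 < hausdorff_measure (DIM('a) - 1) (sphere (0::'a::euclidean_space) 1)"
proof -
  let ?n = "DIM('a)" and ?w = "unit_ball_vol (real DIM('a))"
  let ?d = "?n - 1"
  define S where "S = {z::'a. 1/2 \<le> norm z \<and> norm z \<le> 1}"
  \<comment> \<open>The factor from the cone estimate, with \<open>2 ^ ?d\<close> and the ball
    volume converting a power of the diameter into \<open>hausdorff_weight\<close>.\<close>
  define C where "C = ?w * 2 ^ Suc ?n * 2 ^ ?d / unit_ball_vol (real ?d)"
  have C: "C > 0" by (simp add: C_def)
  have [measurable]: "S \<in> sets borel" unfolding S_def by measurable
  obtain b :: 'a where b: "norm b = 1" using norm_Basis SOME_Basis by blast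
  have "ball ((3/4) *\<^sub>R b) (1/4) \<subseteq> S"
  proof
    fix z assume "z \<in> ball ((3/4) *\<^sub>R b) (1/4)"
    then have "norm ((3/4) *\<^sub>R b - z) < 1/4" by (simp add: dist_norm)
    moreover have "norm ((3/4) *\<^sub>R b) = 3/4" using b by simp
    ultimately show "z \<in> S"
      using norm_triangle_ineq2[of "(3/4) *\<^sub>R b" z] norm_triangle_ineq2[of z "(3/4) *\<^sub>R b"]
      by (simp add: S_def norm_minus_commute)
  qed
  then have "emeasure lborel (ball ((3/4) *\<^sub>R b) (1/4)) \<le> emeasure lborel S"
    by (intro emeasure_mono) auto
  then have Spos: "0 < emeasure lborel S"
    by (rule order_less_le_trans[rotated]) (simp add: emeasure_ball)
  have "emeasure lborel S \<le> emeasure lborel (cball (0::'a) 1)"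
    by (intro emeasure_mono) (auto simp: S_def)
  then have "emeasure lborel S < top" by (rule order_le_less_trans) (simp add: emeasure_lborel_cball_finite[unfolded infinity_ennreal_def])
  then obtain V where V: "emeasure lborel S = ennreal V" "V > 0"
    using Spos by (cases "emeasure lborel S") auto
  have key: "emeasure lborel S \<le> ennreal C * (\<Sum>i. hausdorff_weight ?d (U i))"
    if U: "sphere (0::'a) 1 \<subseteq> (\<Union>i. U i)" "\<And>i. bounded (U i)" "\<And>i. diameter (U i) \<le> 1/2" for U
  proof -
    \<comment> \<open>The covering sets are arbitrary; their closures make the cones Borel and have
      the same diameter.\<close>
    define T where "T i = {z\<in>S. sgn z \<in> closure (U i)}" for i
    have [measurable]: "T i \<in> sets borel" for i
    proof -
      have "T i = S \<inter> (sgn -` closure (U i) \<inter> space borel)" by (auto simp: T_def)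
      then show ?thesis using measurable_sets[OF borel_measurable_sgn_euclidean, of "closure (U i)"] by auto
    qed
    have T: "emeasure lborel (T i) \<le> ennreal C * hausdorff_weight ?d (U i)" for i
    proof (cases "T i = {}")
      case False
      then obtain z where z: "z \<in> S" "sgn z \<in> closure (U i)" by (auto simp: T_def)
      define x where "x = sgn z"
      have x: "norm x = 1" using z by (auto simp: x_def S_def norm_sgn)
      have ne: "U i \<noteq> {}" using z by auto
      let ?D = "diameter (U i)"
      have D: "0 \<le> ?D" "?D \<le> 1/2" using U diameter_ge_0 by auto
      have sub: "T i \<subseteq> {z. 1/2 \<le> norm z \<and> norm z \<le> 1 \<and> dist x (sgn z) \<le> ?D}"
      proof
        fix y assume "y \<in> T i"
        then have "1/2 \<le> norm y" "norm y \<le> 1" "sgn y \<in> closure (U i)" by (auto simp: T_def S_def)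
        moreover have "dist x (sgn y) \<le> diameter (closure (U i))"
          using z(2) calculation(3) U(2)[of i] unfolding x_def
          by (intro diameter_bounded_bound) auto
        ultimately show "y \<in> {z. 1/2 \<le> norm z \<and> norm z \<le> 1 \<and> dist x (sgn z) \<le> ?D}"
          using U(2)[of i] by (simp add: diameter_closure)
      qed
      \<comment> \<open>The cone estimate asks for a positive radius of at most 1, while the
        diameter of \<open>U i\<close> may be 0. It is enlarged by at most 1/2, and the enlargement
        then tends to 0.\<close>
      have *: "emeasure lborel (T i) \<le> ennreal (?w * 2 ^ Suc ?n * (?D + 1 / real (Suc (Suc k))) ^ ?d)" for k
      proof -
        have "1 / real (Suc (Suc k)) \<le> 1 / 2" by (intro divide_left_mono) auto
        moreover have "0 < 1 / real (Suc (Suc k))" by simp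
        ultimately have e: "0 < ?D + 1 / real (Suc (Suc k))" "?D + 1 / real (Suc (Suc k)) \<le> 1"
            "?D \<le> ?D + 1 / real (Suc (Suc k))" using D by linarith+
        let ?E = "{z. 1/2 \<le> norm z \<and> norm z \<le> 1 \<and> dist x (sgn z) \<le> ?D + 1 / real (Suc (Suc k))}"
        have "T i \<subseteq> ?E"
        proof
          fix z assume "z \<in> T i"
          then have "1/2 \<le> norm z" "norm z \<le> 1" "dist x (sgn z) \<le> ?D" using sub by auto
          then show "z \<in> ?E" using order_trans[OF _ e(3)] by simp
        qed
        moreover have "?E \<in> sets lborel" by measurable
        ultimately show ?thesis
          by (intro order_trans[OF _ emeasure_shell_cone_le[OF x e(1,2)]] emeasure_mono)
      qed
      have "(\<lambda>k. ennreal (?w * 2 ^ Suc ?n * (?D + 1 / real (Suc (Suc k))) ^ ?d))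
          \<longlonglongrightarrow> ennreal (?w * 2 ^ Suc ?n * (?D + 0) ^ ?d)"
        by (intro tendsto_ennrealI tendsto_intros LIMSEQ_Suc[OF LIMSEQ_Suc[OF lim_1_over_n]])
      then have "emeasure lborel (T i) \<le> ennreal (?w * 2 ^ Suc ?n * (?D + 0) ^ ?d)"
        using * by (intro LIMSEQ_le_const) auto
      also have "?w * 2 ^ Suc ?n * (?D + 0) ^ ?d = C * (unit_ball_vol (real ?d) * (?D / 2) ^ ?d)"
        by (simp add: C_def power_divide less_imp_neq[symmetric])
      finally show ?thesis
        using ne C by (simp add: hausdorff_weight_def ennreal_mult')
    qed simp
    have "S \<subseteq> (\<Union>i. T i)"
    proof
      fix z assume "z \<in> S"
      then have "sgn z \<in> sphere 0 1" by (auto simp: S_def norm_sgn)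
      then obtain i where "sgn z \<in> U i" using U by blast
      then show "z \<in> (\<Union>i. T i)" using \<open>z \<in> S\<close> closure_subset by (auto simp: T_def)
    qed
    then have "emeasure lborel S \<le> emeasure lborel (\<Union>i. T i)" by (intro emeasure_mono) auto
    also have "\<dots> \<le> (\<Sum>i. emeasure lborel (T i))" by (intro emeasure_subadditive_countably) auto
    also have "\<dots> \<le> (\<Sum>i. ennreal C * hausdorff_weight ?d (U i))" by (intro suminf_le T) auto
    finally show ?thesis by simp
  qed
  have "ennreal (V / C) \<le> hausdorff_premeasure ?d (1/2) (sphere (0::'a) 1)"
  proof (rule hausdorff_premeasure_greatest)
    fix U :: "nat \<Rightarrow> 'a set"
    assume "sphere 0 1 \<subseteq> (\<Union>i. U i)" "\<And>i. bounded (U i)" "\<And>i. diameter (U i) \<le> 1/2"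
    then have "ennreal V \<le> ennreal C * (\<Sum>i. hausdorff_weight ?d (U i))" using key V by simp
    moreover have "ennreal V = ennreal C * ennreal (V / C)" using C V by (simp flip: ennreal_mult)
    ultimately show "ennreal (V / C) \<le> (\<Sum>i. hausdorff_weight ?d (U i))"
      using C by (simp add: ennreal_mult_le_mult_iff)
  qed
  also have "\<dots> \<le> hausdorff_measure ?d (sphere (0::'a) 1)"
    by (rule hausdorff_premeasure_le_measure) simp
  finally have "ennreal (V / C) \<le> hausdorff_measure ?d (sphere (0::'a) 1)" .
  moreover have "0 < ennreal (V / C)" using V C by simp
  ultimately show ?thesis by (rule order_less_le_trans[rotated])
qed

subsection \<open>Uniformly distributed measures\<close>

lemma sets_dist_less [measurable]:
  "{(x, y). dist x y < r} \<in> sets (borel \<Otimes>\<^sub>M (borel :: 'a::{second_countable_topology,metric_space} measure))"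
proof -
  have "open {z :: 'a \<times> 'a. dist (fst z) (snd z) < r}"
    by (intro open_Collect_less continuous_intros)
  then have "{z :: 'a \<times> 'a. dist (fst z) (snd z) < r} \<in> sets borel" by (rule borel_open)
  moreover have "{z :: 'a \<times> 'a. dist (fst z) (snd z) < r} = {(x, y). dist x y < r}" by auto
  ultimately show ?thesis by (simp only: borel_prod)
qed

text \<open>By Tonelli, both sides are the product measure of the set of pairs in
  \<open>U \<times> U\<close> at distance less than \<open>r\<close>.\<close>

lemma nn_integral_emeasure_ball_swap:
  fixes M N :: "'a::{second_countable_topology,metric_space} measure"
  assumes "sigma_finite_measure M" "sigma_finite_measure N"
    and sets: "sets M = sets borel" "sets N = sets borel" and U: "U \<in> sets borel"
  shows "(\<integral>\<^sup>+x. indicator U x * emeasure M (U \<inter> ball x r) \<partial>N)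
       = (\<integral>\<^sup>+y. indicator U y * emeasure N (U \<inter> ball y r) \<partial>M)"
proof -
  interpret pair_sigma_finite M N using assms by (simp add: pair_sigma_finite_def)
  let ?k = "\<lambda>x y. indicator U x * indicator U y * indicator {(x, y). dist x y < r} (x, y) :: ennreal"
  have [measurable]: "U \<in> sets borel" by (rule U)
  have [measurable_cong]: "sets M = sets borel" "sets N = sets borel" by (fact sets)+
  have meas: "(\<lambda>(x, y). ?k x y) \<in> borel_measurable (M \<Otimes>\<^sub>M N)"
    by measurable
  have "(\<integral>\<^sup>+x. indicator U x * emeasure M (U \<inter> ball x r) \<partial>N) = (\<integral>\<^sup>+x. (\<integral>\<^sup>+y. ?k y x \<partial>M) \<partial>N)"
  proof (rule nn_integral_cong)
    fix x
    have "(\<integral>\<^sup>+y. ?k y x \<partial>M) = (\<integral>\<^sup>+y. indicator U x * indicator (U \<inter> ball x r) y \<partial>M)"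
      by (rule nn_integral_cong) (auto simp: indicator_def dist_commute)
    also have "\<dots> = indicator U x * emeasure M (U \<inter> ball x r)"
      using U by (subst nn_integral_cmult_indicator) (auto simp: sets)
    finally show "indicator U x * emeasure M (U \<inter> ball x r) = (\<integral>\<^sup>+y. ?k y x \<partial>M)" by simp
  qed
  also have "\<dots> = (\<integral>\<^sup>+y. (\<integral>\<^sup>+x. ?k y x \<partial>N) \<partial>M)"
    by (rule Fubini'[OF meas])
  also have "\<dots> = (\<integral>\<^sup>+y. indicator U y * emeasure N (U \<inter> ball y r) \<partial>M)"
  proof (rule nn_integral_cong)
    fix x
    have "(\<integral>\<^sup>+y. ?k x y \<partial>N) = (\<integral>\<^sup>+y. indicator U x * indicator (U \<inter> ball x r) y \<partial>N)"
      by (rule nn_integral_cong) (auto simp: indicator_def dist_commute)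
    also have "\<dots> = indicator U x * emeasure N (U \<inter> ball x r)"
      using U by (subst nn_integral_cmult_indicator) (auto simp: sets)
    finally show "(\<integral>\<^sup>+y. ?k x y \<partial>N) = indicator U x * emeasure N (U \<inter> ball x r)" .
  qed
  finally show ?thesis .
qed

lemma measurable_emeasure_Int_ball:
  fixes M :: "'a::{second_countable_topology,metric_space} measure"
  assumes "sigma_finite_measure M" and sets: "sets M = sets borel" and U: "U \<in> sets borel"
  shows "(\<lambda>x. emeasure M (U \<inter> ball x r)) \<in> borel_measurable borel"
proof -
  interpret sigma_finite_measure M by fact
  have [measurable]: "U \<in> sets borel" by (rule U)
  have [measurable_cong]: "sets M = sets borel" by (fact sets)
  have "(UNIV \<times> U) \<inter> {(x, y). dist x y < r} \<in> sets (borel \<Otimes>\<^sub>M M)"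
    using sets_dist_less[of r, where 'a='a] U by (intro sets.Int pair_measureI) (auto simp: sets cong: sets_pair_measure_cong)
  from measurable_emeasure_Pair[OF this]
  have "(\<lambda>x. emeasure M (Pair x -` ((UNIV \<times> U) \<inter> {(x, y). dist x y < r}))) \<in> borel_measurable borel" .
  moreover have "Pair x -` ((UNIV \<times> U) \<inter> {(x, y). dist x y < r}) = U \<inter> ball x r" for x by auto
  ultimately show ?thesis by simp
qed

text \<open>
  Christensen's argument: for \<open>x\<close> in the open set \<open>U\<close> the ratio of \<open>M (U \<inter> ball x r)\<close> and \<open>g r\<close> is
  eventually 1 as \<open>r\<close> tends to 0. Integrate it over \<open>U\<close> with respect to \<open>N\<close>, and use Fatou's lemma and Tonelli's
  theorem, which exchanges the roles of \<open>M\<close> and \<open>N\<close>.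
\<close>
lemma emeasure_open_le_of_equal_balls:
  fixes M N :: "'a::{second_countable_topology,metric_space} measure"
  assumes sf: "sigma_finite_measure M" "sigma_finite_measure N"
    and sets: "sets M = sets borel" "sets N = sets borel"
    and ae: "AE x in M. x \<in> S" "AE x in N. x \<in> S"
    and M: "\<And>x r. x \<in> S \<Longrightarrow> r > 0 \<Longrightarrow> emeasure M (ball x r) = g r"
    and N: "\<And>x r. x \<in> S \<Longrightarrow> r > 0 \<Longrightarrow> emeasure N (ball x r) = g r"
    and g: "\<And>r. r > 0 \<Longrightarrow> g r \<noteq> 0" "\<And>r. r > 0 \<Longrightarrow> g r \<noteq> \<infinity>"
    and U: "open U"
  shows "emeasure N U \<le> emeasure M U"
proof -
  have [measurable_cong]: "sets M = sets borel" "sets N = sets borel" by (fact sets)+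
  have UB [measurable]: "U \<in> sets borel" using U by simp
  define r where "r k = 1 / real (Suc k)" for k
  have r: "r k > 0" for k by (simp add: r_def)
  \<comment> \<open>Intersecting the ball with \<open>U\<close> makes the integrand symmetric in its
    two points, so that after the exchange the integral is again confined to
    \<open>U\<close>.\<close>
  define u where "u k x = inverse (g (r k)) * (indicator U x * emeasure M (U \<inter> ball x (r k)))" for k x
  have [measurable]: "u k \<in> borel_measurable N" for k
    unfolding u_def using measurable_emeasure_Int_ball[OF sf(1) sets(1) UB] by measurable
  have "emeasure N U = (\<integral>\<^sup>+x. indicator U x \<partial>N)" using UB by (simp add: sets)
  also have "\<dots> \<le> (\<integral>\<^sup>+x. liminf (\<lambda>k. u k x) \<partial>N)"
    using ae(2)
  proof (intro nn_integral_mono_AE, eventually_elim)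
    fix x assume x: "x \<in> S"
    show "indicator U x \<le> liminf (\<lambda>k. u k x)"
    proof (cases "x \<in> U")
      case True
      then obtain e where e: "e > 0" "ball x e \<subseteq> U" using U openE by blast
      have "r \<longlonglongrightarrow> 0" unfolding r_def by (rule LIMSEQ_Suc[OF lim_1_over_n])
      then have "eventually (\<lambda>k. r k < e) sequentially" using e(1) by (rule order_tendstoD)
      then have "eventually (\<lambda>k. 1 \<le> u k x) sequentially"
      proof eventually_elim
        case (elim k)
        then have "U \<inter> ball x (r k) = ball x (r k)" using e by auto
        then have "u k x = inverse (g (r k)) * g (r k)" using True M[OF x r] by (simp add: u_def)
        also have "\<dots> = 1"
          using g[OF r] by (simp add: mult.commute ennreal_divide_self[unfolded divide_ennreal_def] less_top)
        finally show ?case by simp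
      qed
      then show ?thesis using True by (simp add: Liminf_bounded)
    qed simp
  qed
  also have "\<dots> \<le> liminf (\<lambda>k. \<integral>\<^sup>+x. u k x \<partial>N)"
    by (rule nn_integral_liminf) simp
  also have "\<dots> \<le> liminf (\<lambda>k. emeasure M U)"
  proof (rule Liminf_mono, rule always_eventually, rule allI)
    fix k
    have "(\<integral>\<^sup>+x. u k x \<partial>N) = inverse (g (r k)) * (\<integral>\<^sup>+x. indicator U x * emeasure M (U \<inter> ball x (r k)) \<partial>N)"
      unfolding u_def using measurable_emeasure_Int_ball[OF sf(1) sets(1) UB]
      by (intro nn_integral_cmult) measurable
    also have "\<dots> = inverse (g (r k)) * (\<integral>\<^sup>+x. indicator U x * emeasure N (U \<inter> ball x (r k)) \<partial>M)"
      using nn_integral_emeasure_ball_swap[OF sf sets UB] by simp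
    also have "\<dots> \<le> inverse (g (r k)) * (\<integral>\<^sup>+x. g (r k) * indicator U x \<partial>M)"
    proof (intro mult_left_mono nn_integral_mono_AE)
      show "AE x in M. indicator U x * emeasure N (U \<inter> ball x (r k)) \<le> g (r k) * indicator U x"
        using ae(1)
      proof eventually_elim
        case (elim x)
        have "emeasure N (U \<inter> ball x (r k)) \<le> emeasure N (ball x (r k))"
          by (intro emeasure_mono) (auto simp: sets)
        then show ?case using N[OF elim r] by (simp add: indicator_def)
      qed
    qed simp
    also have "\<dots> = inverse (g (r k)) * g (r k) * emeasure M U"
      using UB by (simp add: nn_integral_cmult_indicator sets mult.assoc)
    also have "\<dots> = emeasure M U"
      using g[OF r] by (simp add: mult.commute ennreal_divide_self[unfolded divide_ennreal_def] less_top)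
    finally show "(\<integral>\<^sup>+x. u k x \<partial>N) \<le> emeasure M U" .
  qed
  also have "\<dots> = emeasure M U" by (simp add: Liminf_const)
  finally show ?thesis .
qed

text \<open>The one-sided estimate, used in both directions, gives equality on the open sets, an
  intersection-stable generator. Finiteness on balls supplies sigma-finiteness and an exhausting
  sequence around a point of \<open>S\<close>; if \<open>S\<close> is empty, both measures
  vanish.\<close>

lemma measure_eqI_equal_balls:
  fixes M N :: "'a::{second_countable_topology,metric_space} measure"
  assumes sets: "sets M = sets borel" "sets N = sets borel"
    and fin: "\<And>x r. emeasure M (ball x r) \<noteq> \<infinity>" "\<And>x r. emeasure N (ball x r) \<noteq> \<infinity>"
    and ae: "AE x in M. x \<in> S" "AE x in N. x \<in> S"
    and M: "\<And>x r. x \<in> S \<Longrightarrow> r > 0 \<Longrightarrow> emeasure M (ball x r) = g r"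
    and N: "\<And>x r. x \<in> S \<Longrightarrow> r > 0 \<Longrightarrow> emeasure N (ball x r) = g r"
    and g: "\<And>r. r > 0 \<Longrightarrow> g r \<noteq> 0"
  shows "M = N"
proof (cases "S = {}")
  case True
  then have "AE x in M. False" "AE x in N. False" using ae by simp_all
  then have 0: "emeasure M (space M) = 0" "emeasure N (space N) = 0"
    by (auto simp: AE_iff_measurable[OF sets.top])
  show ?thesis
  proof (rule measure_eqI)
    fix A assume "A \<in> sets M"
    then show "emeasure M A = emeasure N A"
      using 0 emeasure_space[of M A] emeasure_space[of N A] by simp
  qed (simp add: sets)
next
  case False
  then obtain a where a: "a \<in> S" by blast
  have g': "g r \<noteq> \<infinity>" if "r > 0" for r using fin(1)[of a r] M[OF a that] by simp
  have UN: "(\<Union>i. ball a (real i)) = UNIV"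
    by (auto simp: set_eq_iff intro: reals_Archimedean2)
  have sf: "sigma_finite_measure L" if "sets L = sets borel" "\<And>x r. emeasure L (ball x r) \<noteq> \<infinity>"
    for L :: "'a measure"
    using that UN sets_eq_imp_space_eq[OF that(1)]
    by (intro sigma_finite_measure.intro exI[of _ "range (\<lambda>i. ball a (real i))"]) auto
  note sfM = sf[OF sets(1) fin(1)] and sfN = sf[OF sets(2) fin(2)]
  show ?thesis
  proof (rule measure_eqI_generator_eq[where E="{U. open U}" and \<Omega>=UNIV and A="\<lambda>i. ball a (real i)"])
    fix U :: "'a set" assume "U \<in> {U. open U}"
    then have U: "open U" by simp
    show "emeasure M U = emeasure N U"
      using emeasure_open_le_of_equal_balls[OF sfM sfN sets ae M N g g' U]
        emeasure_open_le_of_equal_balls[OF sfN sfM sets(2,1) ae(2,1) N M g g' U] by (intro antisym)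
  qed (auto simp: sets UN fin[unfolded infinity_ennreal_def] Int_stable_def borel_def)
qed

text \<open>\<open>measure_orthogonal_image\<close> has this only for well-ordered index types.\<close>
lemma distr_lborel_orthogonal:
  fixes f :: "'a::euclidean_space \<Rightarrow> 'a"
  assumes f: "orthogonal_transformation f"
  shows "distr lborel borel f = lborel"
proof (rule measure_eqI_equal_balls[where S=UNIV])
  have [measurable]: "f \<in> borel_measurable borel"
    using f by (intro borel_measurable_continuous_onI linear_continuous_on linear_conv_bounded_linear[THEN iffD1])
      (simp add: orthogonal_transformation_linear)
  have ball: "emeasure (distr lborel borel f) (ball x r) = emeasure lborel (ball (0::'a) r)" for x r
  proof -
    have "f -` ball x r = ball (inv f x) r"
    proof -
      have "dist x (f y) = dist (inv f x) y" for y
        using f by (metis orthogonal_transformation_isometry orthogonal_transformation_surj surj_f_inv_f)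
      then show ?thesis by auto
    qed
    moreover have "emeasure lborel (ball (inv f x) r) = emeasure lborel (ball (0::'a) r)"
      by (cases "r \<ge> 0") (simp_all add: emeasure_ball ball_empty)
    ultimately show ?thesis by (simp add: emeasure_distr)
  qed
  show "emeasure (distr lborel borel f) (ball x r) = emeasure lborel (ball (0::'a) r)" for x r by (rule ball)
  show "emeasure lborel (ball x r) = emeasure lborel (ball (0::'a) r)" for x :: 'a and r
    by (cases "r \<ge> 0") (simp_all add: emeasure_ball ball_empty)
  show "emeasure lborel (ball (0::'a) r) \<noteq> 0" if "r > 0" for r
    using that by (rule emeasure_ball_neq_0)
  show "emeasure (distr lborel borel f) (ball x r) \<noteq> \<infinity>" "emeasure lborel (ball x r) \<noteq> \<infinity>" for x :: 'a and r
    unfolding ball by (simp_all add: emeasure_ball_ne_top)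
qed simp_all

text \<open>Here it is not given that the two measures assign the same value to balls of equal
  radius. Integrating the measure of a ball under \<open>M\<close> over its centre with respect to
  \<open>N\<close>, and exchanging the two, identifies these values.\<close>

lemma prob_measure_eqI_uniform:
  fixes M N :: "'a::{second_countable_topology,metric_space} measure"
  assumes prob: "prob_space M" "prob_space N"
    and sets: "sets M = sets borel" "sets N = sets borel"
    and ae: "AE x in M. x \<in> S" "AE x in N. x \<in> S"
    and M: "\<And>x y r. x \<in> S \<Longrightarrow> y \<in> S \<Longrightarrow> emeasure M (ball x r) = emeasure M (ball y r)"
    and N: "\<And>x y r. x \<in> S \<Longrightarrow> y \<in> S \<Longrightarrow> emeasure N (ball x r) = emeasure N (ball y r)"
  shows "M = N"
proof -
  interpret M: prob_space M by fact
  interpret N: prob_space N by fact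
  have [simp]: "space M = UNIV" "space N = UNIV"
    using sets_eq_imp_space_eq[OF sets(1)] sets_eq_imp_space_eq[OF sets(2)] by simp_all
  have "S \<noteq> {}" using ae(1) M.AE_False by auto
  then obtain a where a: "a \<in> S" by blast
  have const: "(\<integral>\<^sup>+x. emeasure L (ball x r) \<partial>K) = emeasure L (ball a r)"
    if "prob_space K" "AE x in K. x \<in> S"
      "\<And>x y r. x \<in> S \<Longrightarrow> y \<in> S \<Longrightarrow> emeasure L (ball x r) = emeasure L (ball y r)"
    for K L :: "'a measure" and r
  proof -
    interpret K: prob_space K by fact
    have "(\<integral>\<^sup>+x. emeasure L (ball x r) \<partial>K) = (\<integral>\<^sup>+x. emeasure L (ball a r) \<partial>K)"
    proof (rule nn_integral_cong_AE)
      show "AE x in K. emeasure L (ball x r) = emeasure L (ball a r)"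
        using that(2) by eventually_elim (rule that(3)[OF _ a])
    qed
    then show ?thesis by (simp add: K.emeasure_space_1)
  qed
  have eq: "emeasure M (ball a r) = emeasure N (ball a r)" for r
    using nn_integral_emeasure_ball_swap[OF M.sigma_finite_measure_axioms N.sigma_finite_measure_axioms sets, of UNIV r]
    by (simp add: const[OF prob(2) ae(2) M] const[OF prob(1) ae(1) N])
  show ?thesis
  proof (rule measure_eqI_equal_balls[OF sets _ _ ae, where g="\<lambda>r. emeasure M (ball a r)"])
    show "emeasure M (ball x r) = emeasure M (ball a r)" if "x \<in> S" for x r by (rule M[OF that a])
    show "emeasure N (ball x r) = emeasure M (ball a r)" if "x \<in> S" for x r
      unfolding eq by (rule N[OF that a])
    show "emeasure M (ball x r) \<noteq> \<infinity>" "emeasure N (ball x r) \<noteq> \<infinity>" for x r by simp_all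
    show "emeasure M (ball a r) \<noteq> 0" if "r > 0" for r
    proof
      assume 0: "emeasure M (ball a r) = 0"
      \<comment> \<open>If balls of radius \<open>r\<close> around points of \<open>S\<close> were
        null, countably many of them would cover \<open>S\<close>, contradicting total mass
        1.\<close>
      obtain F where F: "F \<subseteq> (\<lambda>x. ball x r) ` S" "countable F" "\<Union>F = (\<Union>x\<in>S. ball x r)"
        using Lindelof[of "(\<lambda>x. ball x r) ` S"] by auto
      have "B \<in> null_sets M" if "B \<in> F" for B
        using that F(1) 0 M[OF _ a] by (auto simp: null_sets_def sets)
      then have "(\<Union>B\<in>F. B) \<in> null_sets M" using F(2) by (intro null_sets_UN') auto
      then have "(\<Union>x\<in>S. ball x r) \<in> null_sets M" using F(3) by simp
      then have "AE x in M. x \<notin> (\<Union>x\<in>S. ball x r)" by (rule AE_not_in)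
      with ae(1) have "AE x in M. False"
      proof eventually_elim
        case (elim x)
        then show ?case using \<open>r > 0\<close> by force
      qed
      then show False by simp
    qed
  qed
qed

subsection \<open>The uniform measure on the sphere\<close>

text \<open>Defined on the Borel sets of the whole space so that it can be compared with other Borel
  measures. The value \<open>sgn 0 = 0\<close> lies off the sphere, but it arises from a null set
  only.\<close>

definition sphere_measure :: "'a::euclidean_space measure" where
  "sphere_measure = distr (uniform_measure lborel (ball 0 1)) borel sgn"

lemma sets_sphere_measure [simp, measurable_cong]: "sets sphere_measure = sets borel"
  and space_sphere_measure [simp]: "space sphere_measure = UNIV"
  by (simp_all add: sphere_measure_def)

lemma prob_space_sphere_measure: "prob_space sphere_measure"
  unfolding sphere_measure_def
  by (intro prob_space.prob_space_distr prob_space_uniform_measure emeasure_ball_neq_0)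
    (simp_all add: emeasure_ball_ne_top)

lemma emeasure_sphere_measure:
  fixes A :: "'a::euclidean_space set"
  assumes [measurable]: "A \<in> sets borel"
  shows "emeasure sphere_measure A
       = emeasure lborel {y. norm y < 1 \<and> sgn y \<in> A} / emeasure lborel (ball (0::'a) 1)"
proof -
  have "ball 0 1 \<inter> sgn -` A = {y. norm y < 1 \<and> sgn y \<in> A}" by auto
  moreover have "sgn -` A \<in> sets borel"
    using measurable_sets[OF borel_measurable_sgn_euclidean assms] by simp
  ultimately show ?thesis
    unfolding sphere_measure_def by (simp add: emeasure_distr)
qed

lemma AE_sphere_measure: "AE x in sphere_measure. norm (x::'a::euclidean_space) = 1"
proof -
  have "AE y in lborel. y \<noteq> (0::'a)" by (rule AE_lborel_singleton)
  then have "AE y in uniform_measure lborel (ball (0::'a) 1). norm (sgn y) = 1"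
    by (subst AE_uniform_measure)
      (auto simp: emeasure_ball_neq_0 emeasure_ball_ne_top norm_sgn simp flip: top.not_eq_extremum
       elim!: eventually_mono)
  then show ?thesis unfolding sphere_measure_def
    by (subst AE_distr_iff) auto
qed

text \<open>An orthogonal map taking \<open>x\<close> to \<open>y\<close> commutes with
  \<open>sgn\<close> and preserves both the unit ball and volume.\<close>

lemma emeasure_sphere_measure_ball:
  fixes x y :: "real^'n"
  assumes "norm x = 1" "norm y = 1"
  shows "emeasure sphere_measure (ball x r) = emeasure sphere_measure (ball y r)"
proof -
  obtain f where f: "orthogonal_transformation f" "f x = y"
    using orthogonal_transformation_exists assms by metis
  have lin: "linear f" using f(1) by (rule orthogonal_transformation_linear)
  have fm [measurable]: "f \<in> borel_measurable borel"
    using lin by (intro borel_measurable_continuous_onI linear_continuous_on linear_conv_bounded_linear[THEN iffD1])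
  have sgn: "sgn (f z) = f (sgn z)" for z
    using orthogonal_transformation_norm[OF f(1)] by (simp add: sgn_div_norm linear_scale[OF lin])
  have *: "{z. norm z < 1 \<and> sgn z \<in> ball w r} \<in> sets borel" for w :: "real^'n"
    unfolding mem_ball by measurable
  have "emeasure lborel {z. norm z < 1 \<and> sgn z \<in> ball y r}
      = emeasure (distr lborel borel f) {z. norm z < 1 \<and> sgn z \<in> ball y r}"
    by (simp add: distr_lborel_orthogonal[OF f(1)])
  also have "\<dots> = emeasure lborel (f -` {z. norm z < 1 \<and> sgn z \<in> ball y r})"
    using * by (subst emeasure_distr) auto
  also have "f -` {z. norm z < 1 \<and> sgn z \<in> ball y r} = {z. norm z < 1 \<and> sgn z \<in> ball x r}"
    using f by (auto simp: orthogonal_transformation_norm sgn orthogonal_transformation_isometry simp flip: f(2))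
  finally show ?thesis by (simp add: emeasure_sphere_measure)
qed

lemma emeasure_lborel_cone:
  fixes A :: "'a::euclidean_space set"
  assumes A: "A \<in> sets borel" and t: "t > 0"
  shows "emeasure lborel {y. norm y < t \<and> sgn y \<in> A}
       = ennreal (t ^ DIM('a)) * emeasure lborel {y. norm y < 1 \<and> sgn y \<in> A}"
proof -
  have [measurable]: "A \<in> sets borel" by (rule A)
  let ?X = "{y. norm y < t \<and> sgn y \<in> A}"
  have X: "?X \<in> sets borel" by measurable
  have "emeasure lborel ?X = emeasure (density (distr lborel borel (\<lambda>x. 0 + t *\<^sub>R x)) (\<lambda>_. \<bar>t\<bar> ^ DIM('a))) ?X"
    using t by (subst lborel_affine[of t 0]) auto
  also have "\<dots> = ennreal (t ^ DIM('a)) * emeasure lborel ((\<lambda>x. t *\<^sub>R x) -` ?X)"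
    using t X by (simp add: emeasure_density_const emeasure_distr)
  also have "(\<lambda>x. t *\<^sub>R x) -` ?X = {y. norm y < 1 \<and> sgn y \<in> A}"
    using t by (auto simp: sgn_scaleR)
  finally show ?thesis .
qed

text \<open>This replaces integration in polar coordinates: the set on the left is star-shaped with
  the n-th root of \<open>f\<close> as radial function. On a level set of a simple function it is a
  cone, whose volume is known by scaling; monotone convergence does the rest.\<close>

lemma emeasure_lborel_polar:
  fixes f :: "'a::euclidean_space \<Rightarrow> ennreal"
  assumes f: "f \<in> borel_measurable borel"
  shows "emeasure lborel {y. ennreal (norm y ^ DIM('a)) < f (sgn y)}
       = emeasure lborel (ball (0::'a) 1) * (\<integral>\<^sup>+x. f x \<partial>sphere_measure)"
proof -
  let ?n = "DIM('a)" and ?w = "emeasure lborel (ball (0::'a) 1)"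
  have w: "?w \<noteq> 0" "?w \<noteq> top" by (simp_all add: emeasure_ball_neq_0 emeasure_ball_ne_top)
  have simple: "emeasure lborel {y. ennreal (norm y ^ ?n) < s (sgn y)} = ?w * (\<integral>\<^sup>+x. s x \<partial>sphere_measure)"
    if s: "simple_function sphere_measure s" and fin: "\<And>x. s x < top" for s :: "'a \<Rightarrow> ennreal"
  proof -
    have [measurable]: "s \<in> borel_measurable borel"
      using borel_measurable_simple_function[OF s] by (simp cong: measurable_cong_sets)
    have finite: "finite (range s)" using simple_functionD(1)[OF s] by simp
    have level: "emeasure lborel {y. ennreal (norm y ^ ?n) < v \<and> s (sgn y) = v} = ?w * (v * emeasure sphere_measure (s -` {v}))"
      if v: "v \<in> range s" for v
    proof (cases "v = 0")
      case False
      moreover have "v < top" using fin v by auto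
      ultimately obtain t where t: "v = ennreal t" "t > 0" by (cases v) auto
      define q where "q = root ?n t"
      have q: "q > 0" "q ^ ?n = t" using t by (simp_all add: q_def)
      have "ennreal (norm y ^ ?n) < v \<longleftrightarrow> norm y < q" for y :: 'a
      proof -
        have "ennreal (norm y ^ ?n) < v \<longleftrightarrow> norm y ^ ?n < q ^ ?n"
          using t(2) by (simp add: t(1) q(2) ennreal_less_iff)
        also have "\<dots> \<longleftrightarrow> norm y < q"
          using q(1) power_less_imp_less_base[of "norm y" ?n q] power_strict_mono[of "norm y" q ?n] by auto
        finally show ?thesis .
      qed
      then have "{y. ennreal (norm y ^ ?n) < v \<and> s (sgn y) = v} = {y. norm y < q \<and> sgn y \<in> s -` {v}}" by auto
      moreover have sv: "s -` {v} \<in> sets borel"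
        using measurable_sets[of s borel borel "{v}"] by simp
      ultimately have "emeasure lborel {y. ennreal (norm y ^ ?n) < v \<and> s (sgn y) = v}
          = v * emeasure lborel {y. norm y < 1 \<and> sgn y \<in> s -` {v}}"
        using emeasure_lborel_cone[OF sv q(1)] q(2) t(1) by simp
      also have "emeasure lborel {y. norm y < 1 \<and> sgn y \<in> s -` {v}} = ?w * emeasure sphere_measure (s -` {v})"
        by (simp only: emeasure_sphere_measure[OF sv] ennreal_times_divide mult.commute[of ?w] mult_divide_eq_ennreal[OF w])
      finally show ?thesis by (simp add: mult_ac)
    qed simp
    have "{y. ennreal (norm y ^ ?n) < s (sgn y)} = (\<Union>v\<in>range s. {y. ennreal (norm y ^ ?n) < v \<and> s (sgn y) = v})"
      by auto
    also have "emeasure lborel \<dots> = (\<Sum>v\<in>range s. emeasure lborel {y. ennreal (norm y ^ ?n) < v \<and> s (sgn y) = v})"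
      using finite by (intro sum_emeasure[symmetric]) (auto simp: disjoint_family_on_def)
    also have "\<dots> = (\<Sum>v\<in>range s. ?w * (v * emeasure sphere_measure (s -` {v})))"
      by (intro sum.cong level) auto
    also have "\<dots> = ?w * (\<integral>\<^sup>+x. s x \<partial>sphere_measure)"
      by (simp add: nn_integral_eq_simple_integral[OF s] simple_integral_def sum_distrib_left)
    finally show ?thesis .
  qed
  obtain s where s: "\<And>i. simple_function sphere_measure (s i)" "incseq s" "\<And>i x. s i x < top" "\<And>x. (SUP i. s i x) = f x"
    using borel_measurable_implies_simple_function_sequence'[of f sphere_measure] f by (auto cong: measurable_cong_sets)
  have [measurable]: "s i \<in> borel_measurable borel" for i
    using borel_measurable_simple_function[OF s(1)[of i]] by (simp cong: measurable_cong_sets)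
  \<comment> \<open>The strict inequality matters: a number below a supremum is below some member of
    the family, so the set is an increasing union.\<close>
  have "{y. ennreal (norm y ^ ?n) < f (sgn y)} = (\<Union>i. {y. ennreal (norm y ^ ?n) < s i (sgn y)})"
    by (auto simp: less_SUP_iff simp flip: s(4))
  also have "emeasure lborel \<dots> = (SUP i. emeasure lborel {y. ennreal (norm y ^ ?n) < s i (sgn y)})"
    using s(2) by (intro SUP_emeasure_incseq[symmetric]) (auto simp: incseq_def le_fun_def intro: less_le_trans)
  also have "\<dots> = (SUP i. ?w * (\<integral>\<^sup>+x. s i x \<partial>sphere_measure))"
    by (simp add: simple s(1,3))
  also have "\<dots> = ?w * (SUP i. (\<integral>\<^sup>+x. s i x \<partial>sphere_measure))"
    by (simp add: SUP_mult_left_ennreal)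
  also have "(SUP i. (\<integral>\<^sup>+x. s i x \<partial>sphere_measure)) = (\<integral>\<^sup>+x. f x \<partial>sphere_measure)"
    using s(2) by (subst nn_integral_monotone_convergence_SUP[symmetric]) (auto simp: s(4))
  finally show ?thesis .
qed

section \<open>The surface area measure of the ball\<close>

lemma outer_normals_cball:
  assumes "A \<subseteq> sphere 0 1"
  shows "{x \<in> frontier (cball 0 1). \<exists>u\<in>A. outer_unit_normal (cball 0 1) x u} = A"
proof -
  have "outer_unit_normal (cball 0 1) x u \<longleftrightarrow> x = u" if x: "norm x = 1" and u: "norm u = 1" for x u :: "real^'n"
  proof
    assume "outer_unit_normal (cball 0 1) x u"
    \<comment> \<open>Testing the normal at the point \<open>u\<close> of the ball gives
      \<open>x \<bullet> u \<ge> 1\<close>, the equality case of Cauchy-Schwarz for unit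
      vectors.\<close>
    then have "(u - x) \<bullet> u \<le> 0" using u by (auto simp: outer_unit_normal_def)
    moreover have "u \<bullet> u = 1" "x \<bullet> x = 1" using x u by (simp_all add: norm_eq_1)
    ultimately have "(x - u) \<bullet> (x - u) \<le> 0" by (simp add: inner_diff_left inner_diff_right inner_commute)
    then show "x = u" by (metis eq_iff_diff_eq_0 inner_ge_zero inner_eq_zero_iff order_antisym)
  next
    assume "x = u"
    have "y \<bullet> u \<le> u \<bullet> u" if "norm y \<le> 1" for y
      using norm_cauchy_schwarz[of y u] that u by (simp add: norm_eq_1)
    then show "outer_unit_normal (cball 0 1) x u"
      using u \<open>x = u\<close> by (auto simp: outer_unit_normal_def inner_diff_left)
  qed
  then show ?thesis using assms by (force simp: subset_iff)
qed

lemma sets_surface_area_measure: "sets (surface_area_measure K) = sets (restrict_space borel (sphere 0 1))"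
  and space_surface_area_measure: "space (surface_area_measure K) = sphere 0 1"
  unfolding surface_area_measure_def
  using sets.sets_measure_of_eq[of "restrict_space borel (sphere (0::real^'n) 1)"]
    sets.space_measure_of_eq[of "restrict_space borel (sphere (0::real^'n) 1)"]
  by (simp_all add: space_restrict_space)

text \<open>The Gauss map of the ball is the identity, so countable additivity is inherited from the
  Hausdorff measure; without it \<open>emeasure\<close> could not be read off from
  \<open>measure_of\<close>.\<close>

lemma emeasure_surface_area_measure_cball:
  fixes A :: "(real^'n) set"
  assumes A: "A \<in> sets borel" "A \<subseteq> sphere 0 1"
  shows "emeasure (surface_area_measure (cball 0 1)) A = hausdorff_measure (CARD('n) - 1) A"
proof -
  let ?S = "sphere 0 1 :: (real^'n) set"
  let ?R = "sets (restrict_space borel ?S)"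
  let ?\<mu> = "\<lambda>A::(real^'n) set. hausdorff_measure (CARD('n) - 1)
      {x \<in> frontier (cball 0 1). \<exists>u\<in>A. outer_unit_normal (cball 0 1) x u}"
  have R: "B \<in> ?R \<longleftrightarrow> B \<in> sets borel \<and> B \<subseteq> ?S" for B
    by (subst sets_restrict_space_iff) auto
  have \<mu>: "?\<mu> B = hausdorff_measure (CARD('n) - 1) B" if "B \<in> ?R" for B
    using that R outer_normals_cball[of B] by simp
  have ca: "countably_additive (sets borel) (hausdorff_measure (CARD('n) - 1) :: (real^'n) set \<Rightarrow> ennreal)"
    using measure_space_hausdorff by (auto simp: measure_space_def)
  have "countably_additive ?R ?\<mu>"
  proof (rule countably_additiveI)
    fix F :: "nat \<Rightarrow> (real^'n) set"
    assume F: "range F \<subseteq> ?R" "disjoint_family F" "\<Union>(range F) \<in> ?R"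
    have "(\<Sum>i. hausdorff_measure (CARD('n) - 1) (F i)) = hausdorff_measure (CARD('n) - 1) (\<Union>(range F))"
      using F R by (intro ca[unfolded countably_additive_def, rule_format]) auto
    moreover have "?\<mu> (F i) = hausdorff_measure (CARD('n) - 1) (F i)" for i using F(1) by (intro \<mu>) auto
    ultimately show "(\<Sum>i. ?\<mu> (F i)) = ?\<mu> (\<Union>(range F))" using \<mu>[OF F(3)] by simp
  qed
  moreover have "positive ?R ?\<mu>" by (simp add: positive_def)
  moreover have "sets (surface_area_measure (cball 0 1 :: (real^'n) set)) = ?R"
    by (rule sets_surface_area_measure)
  ultimately have "emeasure (surface_area_measure (cball 0 1)) A = ?\<mu> A"
    using A R
    by (intro emeasure_measure_of[OF surface_area_measure_def]) auto
  then show ?thesis using A by (simp only: outer_normals_cball)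
qed

lemma integral_surface_area_measure_cball:
  obtains c where "c > 0"
    "\<And>f :: real^'n \<Rightarrow> real. f \<in> borel_measurable borel \<Longrightarrow>
       (\<integral>x. f x \<partial>surface_area_measure (cball 0 1)) = c * (\<integral>x. f x \<partial>sphere_measure)"
proof -
  let ?S = "sphere 0 1 :: (real^'n) set" and ?B = "cball 0 1 :: (real^'n) set"
  let ?H = "hausdorff_measure (CARD('n) - 1) :: (real^'n) set \<Rightarrow> ennreal"
  obtain c where c: "?H ?S = ennreal c" "c > 0"
    using hausdorff_measure_sphere_finite[where 'a="real^'n"] hausdorff_measure_sphere_pos[where 'a="real^'n"]
    by (cases "?H ?S") auto
  \<comment> \<open>The measure is transported from the sphere to the Borel sets of the whole space,
    where the uniqueness result applies.\<close>
  define \<mu> where "\<mu> = distr (surface_area_measure ?B) borel (\<lambda>x. x)"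
  have id [measurable]: "(\<lambda>x. x) \<in> measurable (surface_area_measure ?B) borel"
    by (simp add: measurable_restrict_space1 sets_surface_area_measure cong: measurable_cong_sets)
  have \<mu>: "emeasure \<mu> A = ?H (A \<inter> ?S)" if "A \<in> sets borel" for A
    using that unfolding \<mu>_def
    by (simp add: emeasure_distr space_surface_area_measure emeasure_surface_area_measure_cball)
  define N where "N = density \<mu> (\<lambda>_. ennreal (1 / c))"
  have sets: "sets N = sets borel" by (simp add: N_def \<mu>_def)
  have N: "emeasure N A = ennreal (1 / c) * ?H (A \<inter> ?S)" if "A \<in> sets borel" for A
    using that \<mu> unfolding N_def by (subst emeasure_density_const) (auto simp: \<mu>_def)
  have "prob_space N"
  proof
    have "emeasure N (space N) = ennreal (1 / c) * ennreal c"
      using N[of UNIV] c sets_eq_imp_space_eq[OF sets] by simp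
    then show "emeasure N (space N) = 1" using c by (simp flip: ennreal_mult)
  qed
  have "N = sphere_measure"
  proof (rule prob_measure_eqI_uniform[OF \<open>prob_space N\<close> prob_space_sphere_measure sets])
    have "emeasure N (- ?S) = 0" using N[of "- ?S"] by (simp add: Int_commute)
    then show "AE x in N. x \<in> ?S"
      by (intro AE_I[of _ _ "- ?S"]) (auto simp: sets)
    show "AE x in sphere_measure. x \<in> ?S" using AE_sphere_measure[where 'a="real^'n"] by simp
    show "emeasure sphere_measure (ball x r) = emeasure sphere_measure (ball y r)" if "x \<in> ?S" "y \<in> ?S" for x y r
      using that by (intro emeasure_sphere_measure_ball) auto
    show "emeasure N (ball x r) = emeasure N (ball y r)" if "x \<in> ?S" "y \<in> ?S" for x y r
    proof -
      have "norm x = norm y" using that by simp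
      then obtain f where f: "orthogonal_transformation f" "f x = y"
        using orthogonal_transformation_exists by metis
      have "f ` (ball x r \<inter> ?S) = ball y r \<inter> ?S"
      proof (intro equalityI subsetI)
        fix z assume "z \<in> f ` (ball x r \<inter> ?S)"
        then show "z \<in> ball y r \<inter> ?S"
          using f by (auto simp: orthogonal_transformation_norm orthogonal_transformation_isometry simp flip: f(2))
      next
        fix z assume z: "z \<in> ball y r \<inter> ?S"
        obtain z' where z': "z = f z'" using orthogonal_transformation_surj[OF f(1)] by (metis surjD)
        then have "z' \<in> ball x r \<inter> ?S"
          using f z by (auto simp: orthogonal_transformation_norm orthogonal_transformation_isometry simp flip: f(2))
        then show "z \<in> f ` (ball x r \<inter> ?S)" using z' by blast
      qed
      then show ?thesis
        using N[of "ball x r"] N[of "ball y r"] hausdorff_measure_orthogonal_image[OF f(1)] by (metis borel_open open_ball)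
    qed
  qed simp
  show ?thesis
  proof (rule that[OF c(2)])
    fix f :: "real^'n \<Rightarrow> real" assume f [measurable]: "f \<in> borel_measurable borel"
    have "(\<integral>x. f x \<partial>sphere_measure) = (\<integral>x. (1 / c) *\<^sub>R f x \<partial>\<mu>)"
      unfolding \<open>N = sphere_measure\<close>[symmetric] N_def using c
      by (intro integral_density) (auto simp: \<mu>_def)
    also have "\<dots> = (1 / c) * (\<integral>x. f x \<partial>surface_area_measure ?B)"
      unfolding \<mu>_def by (subst integral_distr) auto
    finally show "(\<integral>x. f x \<partial>surface_area_measure ?B) = c * (\<integral>x. f x \<partial>sphere_measure)"
      using c by simp
  qed
qed

subsection \<open>Support functions and geominimal surface area\<close>

lemma inner_le_support_function:
  assumes "bounded Q" "x \<in> Q"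
  shows "x \<bullet> u \<le> support_function Q u"
proof -
  obtain R where R: "\<And>x. x \<in> Q \<Longrightarrow> norm x \<le> R" using assms(1) by (auto simp: bounded_iff)
  have "x \<bullet> u \<le> R * norm u" if "x \<in> Q" for x
    using norm_cauchy_schwarz[of x u] mult_right_mono[OF R[OF that] norm_ge_zero[of u]] by simp
  then have "bdd_above ((\<lambda>x. x \<bullet> u) ` Q)" by (intro bdd_aboveI[of _ "R * norm u"]) auto
  then show ?thesis unfolding support_function_def using assms(2) by (intro cSUP_upper)
qed

lemma support_function_le:
  assumes "Q \<noteq> {}" "\<And>x. x \<in> Q \<Longrightarrow> x \<bullet> u \<le> b"
  shows "support_function Q u \<le> b"
  unfolding support_function_def using assms by (intro cSUP_least)

lemma polar_body_eq:
  assumes "bounded Q" "Q \<noteq> {}"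
  shows "polar_body Q = {u. support_function Q u \<le> 1}"
proof (intro equalityI subsetI)
  fix u assume "u \<in> polar_body Q"
  then show "u \<in> {u. support_function Q u \<le> 1}"
    using assms(2) by (auto simp: polar_body_def intro: support_function_le)
next
  fix u assume "u \<in> {u. support_function Q u \<le> 1}"
  then show "u \<in> polar_body Q"
    using order_trans[OF inner_le_support_function[OF assms(1)]] by (auto simp: polar_body_def)
qed

lemma support_function_scaleR:
  assumes Q: "bounded Q" "Q \<noteq> {}" and t: "t > 0"
  shows "support_function Q (t *\<^sub>R u) = t * support_function Q u"
proof -
  \<comment> \<open>One inequality suffices: the reverse one is its instance for \<open>1/t\<close>
    and \<open>t *\<^sub>R u\<close>.\<close>
  have le: "support_function Q (s *\<^sub>R v) \<le> s * support_function Q v" if "s > 0" for s v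
    using that Q by (intro support_function_le) (auto intro!: mult_left_mono inner_le_support_function)
  have "support_function Q u \<le> (1/t) * support_function Q (t *\<^sub>R u)"
    using le[of "1/t" "t *\<^sub>R u"] t by simp
  then show ?thesis using le[OF t, of u] t by (intro antisym) (simp_all add: field_simps)
qed

lemma support_function_ge:
  assumes "bounded Q" "cball 0 r \<subseteq> Q" "r \<ge> 0"
  shows "r * norm u \<le> support_function Q u"
proof -
  have "(r *\<^sub>R sgn u) \<bullet> u = r * norm u"
    by (cases "u = 0") (simp_all add: sgn_div_norm power2_norm_eq_inner[symmetric] power2_eq_square)
  moreover have "r *\<^sub>R sgn u \<in> Q" using assms(2,3) by (intro subsetD[OF assms(2)]) (simp add: norm_sgn)
  ultimately show ?thesis using inner_le_support_function[OF assms(1), of "r *\<^sub>R sgn u" u] by linarith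
qed

lemma support_function_le_norm:
  assumes "Q \<noteq> {}" "Q \<subseteq> cball 0 R"
  shows "support_function Q u \<le> R * norm u"
proof (rule support_function_le[OF assms(1)])
  fix x assume "x \<in> Q"
  then have "norm x * norm u \<le> R * norm u" using assms(2) by (intro mult_right_mono) auto
  then show "x \<bullet> u \<le> R * norm u" using norm_cauchy_schwarz[of x u] by simp
qed

lemma continuous_on_support_function:
  assumes "bounded Q" "Q \<noteq> {}"
  shows "continuous_on UNIV (support_function Q)"
proof -
  obtain R where R: "R > 0" "\<And>x. x \<in> Q \<Longrightarrow> norm x \<le> R" using assms(1) by (auto simp: bounded_pos)
  have le: "support_function Q u \<le> support_function Q v + R * dist u v" for u v
  proof (rule support_function_le[OF assms(2)])
    fix x assume x: "x \<in> Q"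
    have "x \<bullet> (u - v) \<le> R * norm (u - v)"
      using norm_cauchy_schwarz[of x "u - v"] mult_right_mono[OF R(2)[OF x] norm_ge_zero[of "u - v"]] by simp
    then show "x \<bullet> u \<le> support_function Q v + R * dist u v"
      using inner_le_support_function[OF assms(1) x, of v] by (simp add: dist_norm inner_diff_right)
  qed
  have "dist (support_function Q u) (support_function Q v) \<le> R * dist u v" for u v
    using le[of u v] le[of v u] by (simp add: dist_real_def abs_le_iff dist_commute)
  then have "R-lipschitz_on UNIV (support_function Q)"
    using R(1) by (intro lipschitz_onI) auto
  then show ?thesis by (rule lipschitz_on_continuous_on)
qed

lemma support_function_cball: "norm u = 1 \<Longrightarrow> support_function (cball 0 1) u = 1"
  using support_function_ge[of "cball 0 1" 1 u] support_function_le_norm[of "cball 0 1" 1 u]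
  by (intro antisym) auto

lemma convex_bodies0E:
  fixes Q :: "(real^'n) set"
  assumes "Q \<in> convex_bodies0"
  obtains r R where "0 < r" "r \<le> R" "cball 0 r \<subseteq> Q" "Q \<subseteq> cball 0 R" "bounded Q" "Q \<noteq> {}"
proof -
  have Q: "compact Q" "0 \<in> interior Q" using assms by (auto simp: convex_bodies0_def convex_body_def)
  obtain r where r: "r > 0" "cball 0 r \<subseteq> Q" using Q(2) by (auto simp: mem_interior_cball)
  have bdd: "bounded Q" using Q(1) by (rule compact_imp_bounded)
  obtain R where R: "\<And>x. x \<in> Q \<Longrightarrow> norm x \<le> R" using bdd by (auto simp: bounded_iff)
  show ?thesis
    using that[of r "max r R"] r R bdd Q(2) interior_subset by (force simp: le_max_iff_disj)
qed

text \<open>By homogeneity, \<open>y \<noteq> 0\<close> has support value below 1 exactly if its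
  n-th power norm is below the power -n of the support function at \<open>sgn y\<close>. The polar
  body also contains the points of support value 1; they lie on the frontier of a convex set, which
  is null.\<close>

lemma emeasure_polar_body:
  fixes Q :: "(real^'n) set"
  assumes Q: "Q \<in> convex_bodies0"
  shows "emeasure lborel (polar_body Q) = emeasure lborel (ball (0::real^'n) 1)
     * (\<integral>\<^sup>+u. ennreal (support_function Q u powr (- real CARD('n))) \<partial>sphere_measure)"
proof -
  let ?h = "support_function Q" and ?n = "CARD('n)"
  obtain r R where r: "0 < r" "r \<le> R" "cball 0 r \<subseteq> Q" "Q \<subseteq> cball 0 R" and bdd: "bounded Q" and ne: "Q \<noteq> {}"
    using Q by (rule convex_bodies0E)
  have [measurable]: "?h \<in> borel_measurable borel"
    using continuous_on_support_function[OF bdd ne] by (rule borel_measurable_continuous_onI)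
  have hpos: "?h y > 0" if "y \<noteq> 0" for y
  proof -
    have "0 < r * norm y" using r(1) that by simp
    also have "\<dots> \<le> ?h y" using bdd r by (intro support_function_ge) auto
    finally show ?thesis .
  qed
  have "convex (polar_body Q)"
  proof -
    have "polar_body Q = (\<Inter>x\<in>Q. {y. x \<bullet> y \<le> 1})" by (auto simp: polar_body_def)
    then show ?thesis by (auto intro!: convex_INT convex_halfspace_le)
  qed
  then have "negligible (frontier (polar_body Q))" by (rule negligible_convex_frontier)
  moreover have "{y. ?h y = 1} \<subseteq> frontier (polar_body Q)"
  proof
    fix y assume "y \<in> {y. ?h y = 1}"
    then have y: "?h y = 1" by simp
    then have "y \<in> polar_body Q" by (simp add: polar_body_eq[OF bdd ne])
    moreover have "y \<notin> interior (polar_body Q)"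
    proof
      assume "y \<in> interior (polar_body Q)"
      then obtain e where e: "e > 0" "cball y e \<subseteq> polar_body Q" by (auto simp: mem_interior_cball)
      \<comment> \<open>Small enough for \<open>(1 + d) *\<^sub>R y\<close> to stay in the ball
        around \<open>y\<close>, although its support value is \<open>1 + d\<close>. The summand 1
        keeps the denominator positive.\<close>
      define d where "d = e / (1 + norm y)"
      have np: "0 < 1 + norm y" by (rule add_pos_nonneg) auto
      have d: "d > 0" using e np by (simp add: d_def)
      have "d * norm y \<le> d * (1 + norm y)" using d by (intro mult_left_mono) auto
      also have "\<dots> = e" using np by (simp add: d_def)
      finally have "norm (d *\<^sub>R y) \<le> e" using d by simp
      then have "(1 + d) *\<^sub>R y \<in> cball y e" by (simp add: dist_norm scaleR_add_left)
      then have "?h ((1 + d) *\<^sub>R y) \<le> 1" using e polar_body_eq[OF bdd ne] by auto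
      then show False using support_function_scaleR[OF bdd ne, of "1 + d" y] d y by simp
    qed
    ultimately show "y \<in> frontier (polar_body Q)" using closure_subset by (auto simp: frontier_def)
  qed
  ultimately have "negligible {y. ?h y = 1}" by (rule negligible_subset)
  then have "{y. ?h y = 1} \<in> null_sets lborel"
    by (simp add: negligible_iff_null_sets null_sets_completion_iff)
  then have "AE y in lborel. y \<notin> {y. ?h y = 1}" by (rule AE_not_in)
  moreover have "AE y in lborel. y \<noteq> (0::real^'n)" by (rule AE_lborel_singleton)
  ultimately have "AE y in lborel. y \<in> polar_body Q
      \<longleftrightarrow> y \<in> {y. ennreal (norm y ^ ?n) < ennreal (?h (sgn y) powr (- real ?n))}"
  proof eventually_elim
    case (elim y)
    have h: "?h (sgn y) = ?h y / norm y" "?h y > 0" "norm y > 0"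
      using support_function_scaleR[OF bdd ne, of "inverse (norm y)" y] hpos[OF elim(2)] elim(2)
      by (simp_all add: sgn_div_norm field_simps)
    then have "?h (sgn y) powr (- real ?n) = norm y ^ ?n / ?h y ^ ?n"
      by (simp add: powr_minus_divide powr_realpow power_divide)
    then have "ennreal (norm y ^ ?n) < ennreal (?h (sgn y) powr (- real ?n)) \<longleftrightarrow> ?h y ^ ?n < 1"
      using h(2,3) by (simp add: ennreal_less_iff pos_less_divide_eq)
    also have "\<dots> \<longleftrightarrow> ?h y < 1"
      using h(2) power_less_imp_less_base[of "?h y" ?n 1] power_strict_mono[of "?h y" 1 ?n] by auto
    also have "\<dots> \<longleftrightarrow> y \<in> polar_body Q"
      using elim(1) by (auto simp: polar_body_eq[OF bdd ne])
    finally show ?case by simp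
  qed
  then have "emeasure lborel (polar_body Q)
      = emeasure lborel {y. ennreal (norm y ^ ?n) < ennreal (?h (sgn y) powr (- real ?n))}"
    by (rule emeasure_eq_AE) (simp_all add: polar_body_eq[OF bdd ne])
  also have "\<dots> = emeasure lborel (ball (0::real^'n) 1)
     * (\<integral>\<^sup>+u. ennreal (?h u powr (- real ?n)) \<partial>sphere_measure)"
    using emeasure_lborel_polar[of "\<lambda>u. ennreal (?h u powr (- real ?n))"] by simp
  finally show ?thesis .
qed

section \<open>Power moments and Jensen's inequality\<close>

lemma convex_on_powr:
  assumes "0 \<le> s * (q * (q - 1))"
  shows "convex_on {0<..} (\<lambda>x::real. s * x powr q)"
proof (rule f''_ge0_imp_convex)
  fix x :: real assume x: "x \<in> {0<..}"
  show "((\<lambda>x. s * x powr q) has_real_derivative s * (q * x powr (q - 1))) (at x)"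
    using x by (auto intro!: derivative_eq_intros)
  show "((\<lambda>x. s * (q * x powr (q - 1))) has_real_derivative s * (q * (q - 1)) * x powr (q - 1 - 1)) (at x)"
    using x by (auto intro!: derivative_eq_intros)
  show "0 \<le> s * (q * (q - 1)) * x powr (q - 1 - 1)" using assms by simp
qed simp

lemma powr_between:
  fixes x :: real
  assumes "0 < r" "r \<le> x" "x \<le> R"
  shows "min (r powr p) (R powr p) \<le> x powr p" "x powr p \<le> max (r powr p) (R powr p)"
  using assms powr_mono2[of p r x] powr_mono2[of p x R] powr_mono2'[of p r x] powr_mono2'[of p x R]
  by (cases "p \<ge> 0"; simp add: min_le_iff_disj le_max_iff_disj)+

text \<open>Bounds away from 0 and infinity make the moments of every real order finite and
  positive. The factor \<open>s\<close> is later set to 1 where the power \<open>q\<close> is convex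
  and to -1 where it is concave, so that one statement covers both directions of Jensen's
  inequality.\<close>

lemma (in prob_space) powr_moments:
  fixes h :: "'a \<Rightarrow> real"
  assumes h: "h \<in> borel_measurable M" and r: "0 < r" and bounds: "AE x in M. r \<le> h x \<and> h x \<le> R"
  shows integrable_powr: "integrable M (\<lambda>x. h x powr p)"
    and expectation_powr_pos: "expectation (\<lambda>x. h x powr p) > 0"
    and jensen_powr: "0 \<le> s * (q * (q - 1)) \<Longrightarrow>
      s * expectation (\<lambda>x. h x powr p) powr q \<le> s * expectation (\<lambda>x. h x powr (p * q))"
proof -
  have bd: "AE x in M. min (r powr p) (R powr p) \<le> h x powr p \<and> h x powr p \<le> max (r powr p) (R powr p)" for p
    using bounds by eventually_elim (use r powr_between in blast)
  have [measurable]: "h \<in> borel_measurable M" by (rule h)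
  have int: "integrable M (\<lambda>x. h x powr p)" for p
    by (rule integrable_const_bound[where B="max (r powr p) (R powr p)"]) (use bd[of p] in \<open>auto elim: eventually_mono\<close>)
  show "integrable M (\<lambda>x. h x powr p)" by (rule int)
  have "AE x in M. r \<le> R" using bounds by eventually_elim simp
  then have "r \<le> R" by simp
  then have "0 < min (r powr p) (R powr p)" using r by simp
  also have "\<dots> \<le> expectation (\<lambda>x. h x powr p)"
    using bd[of p] by (intro integral_ge_const int) (auto elim: eventually_mono)
  finally show "expectation (\<lambda>x. h x powr p) > 0" .
  assume s: "0 \<le> s * (q * (q - 1))"
  have eq: "h x powr (p * q) = (h x powr p) powr q" for x by (simp add: powr_powr)
  have "s * expectation (\<lambda>x. h x powr p) powr q \<le> expectation (\<lambda>x. s * (h x powr p) powr q)"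
  proof (rule jensens_inequality[where I="{0<..}"])
    show "AE x in M. h x powr p \<in> {0<..}" using bounds by eventually_elim (use r in auto)
    show "integrable M (\<lambda>x. s * (h x powr p) powr q)"
      unfolding eq[symmetric] by (intro integrable_mult_right int)
  qed (auto intro: int convex_on_powr[OF s])
  then show "s * expectation (\<lambda>x. h x powr p) powr q \<le> s * expectation (\<lambda>x. h x powr (p * q))"
    by (simp add: eq)
qed

section \<open>The functional on the unit ball\<close>

lemma cball_in_convex_bodies0: "(cball 0 1 :: (real^'n) set) \<in> convex_bodies0"
  by (simp add: convex_bodies0_def convex_body_def)

lemma Lp_mixed_volume_nonneg: "Lp_mixed_volume p K Q \<ge> 0"
  by (simp add: Lp_mixed_volume_def)

text \<open>The order of the quantifiers is the point: a single \<open>c\<close> serves all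
  \<open>p\<close> and \<open>Q\<close>. The factor from the ball disappears because its support
  function is 1 on the sphere.\<close>

lemma Lp_mixed_volume_cball:
  obtains c where "c > 0"
    "\<And>p (Q :: (real^'n) set). Q \<in> convex_bodies0 \<Longrightarrow>
       Lp_mixed_volume p (cball 0 1) Q = c * (\<integral>u. support_function Q u powr p \<partial>sphere_measure)"
proof -
  obtain c where c: "c > 0" "\<And>f :: real^'n \<Rightarrow> real. f \<in> borel_measurable borel \<Longrightarrow>
       (\<integral>x. f x \<partial>surface_area_measure (cball 0 1)) = c * (\<integral>x. f x \<partial>sphere_measure)"
    by (rule integral_surface_area_measure_cball) blast
  show ?thesis
  proof (rule that[of "c / real CARD('n)"])
    fix p and Q :: "(real^'n) set" assume Q: "Q \<in> convex_bodies0"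
    then have [measurable]: "support_function Q \<in> borel_measurable borel"
      by (elim convex_bodies0E) (intro borel_measurable_continuous_onI continuous_on_support_function)
    have "(\<integral>u. support_function Q u powr p * support_function (cball 0 1) u powr (1 - p)
          \<partial>surface_area_measure (cball 0 1 :: (real^'n) set))
        = (\<integral>u. support_function Q u powr p \<partial>surface_area_measure (cball 0 1 :: (real^'n) set))"
      by (intro Bochner_Integration.integral_cong)
        (auto simp: space_surface_area_measure support_function_cball)
    also have "\<dots> = c * (\<integral>u. support_function Q u powr p \<partial>sphere_measure)"
      by (rule c(2)) measurable
    finally show "Lp_mixed_volume p (cball 0 1) Q
        = c / real CARD('n) * (\<integral>u. support_function Q u powr p \<partial>sphere_measure)"
      by (simp add: Lp_mixed_volume_def)
  qed (use c(1) in simp)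
qed

lemma sphere_support_function:
  fixes Q :: "(real^'n) set"
  assumes "Q \<in> convex_bodies0"
  obtains r R where "0 < r" "support_function Q \<in> borel_measurable sphere_measure"
    "AE u in sphere_measure. r \<le> support_function Q u \<and> support_function Q u \<le> R"
proof -
  obtain r R where r: "0 < r" "r \<le> R" "cball 0 r \<subseteq> Q" "Q \<subseteq> cball 0 R" and bdd: "bounded Q" and ne: "Q \<noteq> {}"
    using assms by (rule convex_bodies0E)
  have "support_function Q \<in> borel_measurable borel"
    by (intro borel_measurable_continuous_onI continuous_on_support_function bdd ne)
  then have "support_function Q \<in> borel_measurable sphere_measure" by (simp cong: measurable_cong_sets)
  moreover have "AE u in sphere_measure. r \<le> support_function Q u \<and> support_function Q u \<le> R"
    using AE_sphere_measure
  proof eventually_elim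
    case (elim u)
    then show ?case
      using support_function_ge[OF bdd r(3), of u] support_function_le_norm[OF ne r(4), of u] r(1) by simp
  qed
  ultimately show ?thesis using that r(1) by blast
qed

lemma measure_polar_body:
  fixes Q :: "(real^'n) set"
  assumes Q: "Q \<in> convex_bodies0"
  shows "measure lebesgue (polar_body Q) = measure lborel (ball (0::real^'n) 1)
     * (\<integral>u. support_function Q u powr (- real CARD('n)) \<partial>sphere_measure)"
proof -
  interpret prob_space "sphere_measure :: (real^'n) measure" by (rule prob_space_sphere_measure)
  obtain r R where r: "0 < r" "support_function Q \<in> borel_measurable sphere_measure"
    "AE u in sphere_measure. r \<le> support_function Q u \<and> support_function Q u \<le> R"
    using Q by (rule sphere_support_function)
  have "closed (polar_body Q)"
  proof -
    have "polar_body Q = (\<Inter>x\<in>Q. {y. x \<bullet> y \<le> 1})" by (auto simp: polar_body_def)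
    then show ?thesis by (auto intro!: closed_INT closed_halfspace_le)
  qed
  then have "measure lebesgue (polar_body Q) = measure lborel (polar_body Q)"
    by (intro measure_completion) simp
  also have "\<dots> = enn2real (emeasure lborel (ball (0::real^'n) 1)
     * (\<integral>\<^sup>+u. ennreal (support_function Q u powr (- real CARD('n))) \<partial>sphere_measure))"
    by (simp only: measure_def emeasure_polar_body[OF Q])
  also have "(\<integral>\<^sup>+u. ennreal (support_function Q u powr (- real CARD('n))) \<partial>sphere_measure)
     = ennreal (\<integral>u. support_function Q u powr (- real CARD('n)) \<partial>sphere_measure)"
    by (intro nn_integral_eq_integral integrable_powr[OF r(2,1,3)]) simp
  finally show ?thesis by (simp add: enn2real_mult measure_def)
qed

text \<open>Up to the constant \<open>C\<close> the functional is
  \<open>I Q powr a * J Q powr b\<close>. Since \<open>q * a = - b\<close>, this product would be 1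
  if \<open>I Q\<close> were equal to \<open>J Q powr q\<close>, and Jensen's inequality compares
  these two numbers. For the ball all moments are 1.\<close>

proposition geominimal_functional_cball:
  fixes Q :: "(real^'n) set"
  assumes Q: "Q \<in> convex_bodies0" and p: "p \<noteq> - real CARD('n)"
  shows "p \<ge> 0 \<Longrightarrow> geominimal_functional p (cball 0 1) (cball 0 1 :: (real^'n) set)
                  \<le> geominimal_functional p (cball 0 1) Q"
    and "p < 0 \<Longrightarrow> geominimal_functional p (cball 0 1) Q
                  \<le> geominimal_functional p (cball 0 1) (cball 0 1 :: (real^'n) set)"
proof -
  let ?n = "real CARD('n)" and ?B = "cball 0 1 :: (real^'n) set"
  define a b q where "a = ?n / (?n + p)" and "b = p / (?n + p)" and "q = - p / ?n"
  define I J where "I = (\<lambda>Q :: (real^'n) set. \<integral>u. support_function Q u powr p \<partial>sphere_measure)"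
    and "J = (\<lambda>Q :: (real^'n) set. \<integral>u. support_function Q u powr (- ?n) \<partial>sphere_measure)"
  interpret prob_space "sphere_measure :: (real^'n) measure" by (rule prob_space_sphere_measure)
  have n: "?n > 0" by simp
  have np: "?n + p \<noteq> 0" using p by linarith
  have qa: "q * a = - b" using n np by (simp add: q_def a_def b_def)
  obtain c where c: "c > 0" "\<And>p (Q :: (real^'n) set). Q \<in> convex_bodies0 \<Longrightarrow>
       Lp_mixed_volume p (cball 0 1) Q = c * (\<integral>u. support_function Q u powr p \<partial>sphere_measure)"
    by (rule Lp_mixed_volume_cball) blast
  define w where "w = measure lborel (ball (0::real^'n) 1)"
  have w: "w > 0" by (simp add: w_def content_ball)
  define C where "C = ?n * c powr a * w powr b"
  have C: "C > 0" using c(1) w by (simp add: C_def)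
  have pos: "I Q > 0" "J Q > 0" if "Q \<in> convex_bodies0" for Q
    using that expectation_powr_pos unfolding I_def J_def by (elim sphere_support_function; blast)+
  have F: "geominimal_functional p ?B Q = C * (I Q powr a * J Q powr b)" if "Q \<in> convex_bodies0" for Q
  proof -
    have "Lp_mixed_volume p ?B Q = c * I Q" "measure lebesgue (polar_body Q) = w * J Q"
      by (simp_all add: c(2)[OF that] measure_polar_body[OF that] I_def J_def w_def)
    then show ?thesis
      using c(1) w pos[OF that] by (simp add: geominimal_functional_def C_def a_def b_def powr_mult)
  qed
  \<comment> \<open>Jensen's inequality for the moment of order \<open>- ?n\<close>, whose exponent
    is multiplied by \<open>q\<close> to give \<open>p\<close>.\<close>
  have IJ: "s * J Q powr q \<le> s * I Q" if "0 \<le> s * (q * (q - 1))" for s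
  proof -
    have "- ?n * q = p" using n by (simp add: q_def)
    moreover obtain r R where r: "0 < r" "support_function Q \<in> borel_measurable sphere_measure"
      "AE u in sphere_measure. r \<le> support_function Q u \<and> support_function Q u \<le> R"
      using Q by (rule sphere_support_function)
    ultimately show ?thesis using jensen_powr[OF r(2,1,3) that, of "- ?n"] by (simp only: I_def J_def)
  qed
  have one: "expectation (\<lambda>u. support_function ?B u powr s) = 1" for s
  proof -
    have "expectation (\<lambda>u. support_function ?B u powr s) = expectation (\<lambda>u. 1)"
    proof (rule integral_cong_AE)
      show "AE u in sphere_measure. support_function ?B u powr s = 1"
        using AE_sphere_measure by eventually_elim (simp add: support_function_cball)
      have [measurable]: "support_function ?B \<in> borel_measurable sphere_measure"
        by (rule sphere_support_function[OF cball_in_convex_bodies0])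
      show "(\<lambda>u. support_function ?B u powr s) \<in> borel_measurable sphere_measure"
        by measurable
    qed simp
    then show ?thesis using prob_space by simp
  qed
  have FB: "geominimal_functional p ?B ?B = C"
    using F[OF cball_in_convex_bodies0] by (simp add: I_def J_def one)
  have J1: "(J Q powr q) powr a * J Q powr b = 1"
    using pos[OF Q] by (simp add: powr_powr qa powr_add[symmetric])
  note posQ = pos[OF Q]
  show "geominimal_functional p ?B ?B \<le> geominimal_functional p ?B Q" if "p \<ge> 0"
  proof -
    have "q \<le> 0" "a \<ge> 0" using that n by (simp_all add: q_def a_def)
    then have "J Q powr q \<le> I Q" using IJ[of 1] by (simp add: mult_nonpos_nonpos)
    then have "(J Q powr q) powr a * J Q powr b \<le> I Q powr a * J Q powr b"
      using \<open>a \<ge> 0\<close> posQ by (intro mult_right_mono powr_mono2) auto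
    then show ?thesis using C by (simp add: FB F[OF Q] J1)
  qed
  show "geominimal_functional p ?B Q \<le> geominimal_functional p ?B ?B" if "p < 0"
  proof -
    have "I Q powr a \<le> (J Q powr q) powr a"
    proof (cases "?n + p > 0")
      \<comment> \<open>For p between -n and 0 the power \<open>q\<close> is concave, so Jensen
        bounds \<open>I Q\<close> from above, and the exponent \<open>a\<close> is positive.\<close>
      case True
      then have "0 \<le> q" "q \<le> 1" "a \<ge> 0" using that n by (simp_all add: q_def a_def field_simps)
      then have "I Q \<le> J Q powr q" using IJ[of "-1"] by (simp add: mult_nonneg_nonpos)
      then show ?thesis using \<open>a \<ge> 0\<close> posQ by (intro powr_mono2) auto
    next
      \<comment> \<open>Below -n the power \<open>q\<close> is convex and Jensen's inequality is
        reversed, but raising to the negative exponent \<open>a\<close> reverses it once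
        more.\<close>
      case False
      then have "1 \<le> q" "a \<le> 0" using that n by (simp_all add: q_def a_def field_simps divide_nonneg_nonpos)
      then have "J Q powr q \<le> I Q" using IJ[of 1] by simp
      then show ?thesis using \<open>a \<le> 0\<close> posQ by (intro powr_mono2') auto
    qed
    then have "I Q powr a * J Q powr b \<le> (J Q powr q) powr a * J Q powr b"
      by (intro mult_right_mono) auto
    then show ?thesis using C by (simp add: FB F[OF Q] J1)
  qed
qed

theorem proposition4p3:
  fixes K :: "(real^'n) set"
  assumes "convex_body K" and "0 \<in> interior K"
  shows "(\<forall>p::real. p \<ge> 0 \<longrightarrow>
            Lp_geominimal p K / Lp_geominimal p (cball 0 1 :: (real^'n) set)
              \<le> ereal ((p_surface_area p K / p_surface_area p (cball 0 1 :: (real^'n) set))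
                   powr (real CARD('n) / (real CARD('n) + p)))) \<and>
         (\<forall>p::real. p < 0 \<and> p \<noteq> - real CARD('n) \<longrightarrow>
            Lp_geominimal p K / Lp_geominimal p (cball 0 1 :: (real^'n) set)
              \<ge> ereal ((p_surface_area p K / p_surface_area p (cball 0 1 :: (real^'n) set))
                   powr (real CARD('n) / (real CARD('n) + p))))"
proof -
  let ?n = "real CARD('n)" and ?B = "cball 0 1 :: (real^'n) set"
  note B = cball_in_convex_bodies0[where 'n='n]
  interpret prob_space "sphere_measure :: (real^'n) measure" by (rule prob_space_sphere_measure)
  have moment: "(\<integral>u. support_function ?B u powr s \<partial>sphere_measure) > 0" for s
    using B by (rule sphere_support_function) (rule expectation_powr_pos)
  have V: "Lp_mixed_volume p ?B ?B > 0" for p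
  proof -
    obtain c where c: "c > 0" "\<And>p (Q :: (real^'n) set). Q \<in> convex_bodies0 \<Longrightarrow>
         Lp_mixed_volume p (cball 0 1) Q = c * (\<integral>u. support_function Q u powr p \<partial>sphere_measure)"
      by (rule Lp_mixed_volume_cball) blast
    show ?thesis using c(1) moment by (simp add: c(2)[OF B])
  qed
  have P: "measure lebesgue (polar_body ?B) > 0"
    using moment[of "- ?n"] by (simp add: measure_polar_body[OF B] content_ball)
  have FB: "geominimal_functional p ?B ?B > 0" for p
    using V[of p] P by (simp add: geominimal_functional_def)
  \<comment> \<open>With the ball as test body the polar volume cancels from the quotient.
    Distributing \<open>powr\<close> over the remaining quotient rests on the mixed volume of
    \<open>K\<close> being nonnegative.\<close>
  have ratio: "geominimal_functional p K ?B / geominimal_functional p ?B ?B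
      = (p_surface_area p K / p_surface_area p ?B) powr (?n / (?n + p))" for p
    using V[of p] P Lp_mixed_volume_nonneg[of p K ?B]
    by (simp add: geominimal_functional_def p_surface_area_def powr_divide)
  show ?thesis
  proof (intro conjI allI impI)
    fix p :: real assume p: "p \<ge> 0"
    then have np: "p \<noteq> - ?n" using zero_less_card_finite[where 'a='n] by linarith
    have "Lp_geominimal p ?B = ereal (geominimal_functional p ?B ?B)"
      using p B geominimal_functional_cball(1)[OF _ np p]
      by (auto simp: Lp_geominimal_def intro!: antisym INF_lower INF_greatest)
    moreover have "Lp_geominimal p K \<le> ereal (geominimal_functional p K ?B)"
      using p B by (auto simp: Lp_geominimal_def intro!: INF_lower)
    ultimately have "Lp_geominimal p K / Lp_geominimal p ?B
        \<le> ereal (geominimal_functional p K ?B) / ereal (geominimal_functional p ?B ?B)"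
      using FB[of p] by (simp add: ereal_divide_right_mono del: ereal_divide)
    then show "Lp_geominimal p K / Lp_geominimal p ?B
        \<le> ereal ((p_surface_area p K / p_surface_area p ?B) powr (?n / (?n + p)))"
      using FB[of p] by (simp add: ratio)
  next
    fix p :: real assume p: "p < 0 \<and> p \<noteq> - ?n"
    have "geominimal_functional p ?B Q \<le> geominimal_functional p ?B ?B" if "Q \<in> convex_bodies0" for Q
      using p geominimal_functional_cball(2)[OF that] by simp
    then have "Lp_geominimal p ?B = ereal (geominimal_functional p ?B ?B)"
      using p B by (auto simp: Lp_geominimal_def intro!: antisym SUP_upper SUP_least)
    moreover have "ereal (geominimal_functional p K ?B) \<le> Lp_geominimal p K"
      using p B by (auto simp: Lp_geominimal_def intro!: SUP_upper)
    \<comment> \<open>The supremum for \<open>K\<close> may be infinite; division by the finite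
      positive value of the ball is still monotone in \<open>ereal\<close>.\<close>
    ultimately have "ereal (geominimal_functional p K ?B) / ereal (geominimal_functional p ?B ?B)
        \<le> Lp_geominimal p K / Lp_geominimal p ?B"
      using FB[of p] by (simp add: ereal_divide_right_mono del: ereal_divide)
    then show "ereal ((p_surface_area p K / p_surface_area p ?B) powr (?n / (?n + p)))
        \<le> Lp_geominimal p K / Lp_geominimal p ?B"
      using FB[of p] by (simp add: ratio)
  qed
qed

end
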